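(* Assume $1<\lambda<2$, let $(a_n)_{n=0}^{\infty}\subset S^1$ be a greedy $\lambda$-energy sequence with $a_0=1$, and let $\alpha_{N,\lambda}=(a_0,\ldots,a_{N-1})$, $N\geq 2$. The sequence $$(H_\lambda(\alpha_{N,\lambda})-N^2 I_\lambda(\sigma_1))_{N=2}^{\infty}$$ is bounded and divergent (i.e., not convergent). We have $$\limsup_{N\to\infty}\,(H_\lambda(\alpha_{N,\lambda})-N^2\,I_\lambda(\sigma_1))=0,$$ $$\liminf_{N\to\infty}\,(H_\lambda(\alpha_{N,\lambda})-N^2\,I_\lambda(\sigma_1))\leq s_\lambda,$$ where $$s_\lambda:=\frac13\sum_{k=0}^{\infty}\left(1+\frac{(-1)^k}{2^{k-1}}\right)(\mathcal{L}_\lambda(2^k)-2^{2k}I_\lambda(\sigma_1)).$$ We also have $$\liminf_{N\to\infty}\,(H_\lambda(\alpha_{N,\lambda})-N^2\,I_\lambda(\sigma_1))=\inf_{N\geq 2}\,\{H_\lambda(\alpha_{N,\lambda})-N^2\,I_\lambda(\sigma_1)\}.$$ Each term in the sequence $(H_\lambda(\alpha_{N,\lambda})-N^2 I_\lambda(\sigma_1))_{N=2}^{\infty}$ is a limit point of the sequence itself (i.e., the limit of some subsequence).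
   Context: $S^1$ is the unit circle, viewed as the set of complex numbers of modulus $1$. For $\lambda>0$, a greedy $\lambda$-energy sequence on $S^1$ is a sequence $(a_n)_{n=0}^{\infty}\subset S^1$ such that $\sum_{k=0}^{n-1}|a_n-a_k|^{\lambda}=\max_{x\in S^1}\sum_{k=0}^{n-1}|x-a_k|^{\lambda}$ for all $n\geq 1$. For a configuration $\omega_N=(y_0,\ldots,y_{N-1})$ of $N\ge2$ points, $H_\lambda(\omega_N)=\sum_{0\le i\neq j\le N-1}|y_i-y_j|^\lambda$. $\sigma_1$ is the normalized arc-length (uniform probability) measure on $S^1$, and $I_\lambda(\sigma_1)=\iint_{S^1\times S^1}|x-y|^\lambda\,d\sigma_1(x)\,d\sigma_1(y)=\frac{2^{\lambda}\,\Gamma((1+\lambda)/2)}{\sqrt{\pi}\,\Gamma(1+\lambda/2)}$. For $N\geq 1$, $\mathcal{L}_\lambda(N)=N\,2^\lambda\sum_{k=1}^{N-1}\left(\sin\frac{\pi k}{N}\right)^\lambda$ (the $\lambda$-energy of $N$ equally spaced points on $S^1$), with $\mathcal{L}_\lambda(1)=0$. *)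

theory Defs
  imports "HOL-Analysis.Analysis"
begin

definition S1 :: "complex set" where
  "S1 = sphere 0 1"

definition greedy_energy_seq :: "real \<Rightarrow> (nat \<Rightarrow> complex) \<Rightarrow> bool" where
  "greedy_energy_seq l a \<longleftrightarrow>
     (\<forall>n. a n \<in> S1) \<and>
     (\<forall>n\<ge>1. \<forall>x\<in>S1. (\<Sum>k<n. cmod (x - a k) powr l) \<le> (\<Sum>k<n. cmod (a n - a k) powr l))"

text \<open>Energy of the configuration \<open>(y 0, \<dots>, y (N - 1))\<close>; the sum is over ordered pairs.\<close>

definition energy :: "real \<Rightarrow> nat \<Rightarrow> (nat \<Rightarrow> complex) \<Rightarrow> real" where
  "energy l N y = (\<Sum>i<N. \<Sum>j\<in>{..<N} - {i}. cmod (y i - y j) powr l)"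

text \<open>Normalized arc length, as a Borel measure on the plane that is concentrated on the circle.\<close>

definition sigma1 :: "complex measure" where
  "sigma1 = distr (uniform_measure lborel {0..<2 * pi}) borel cis"

definition cont_energy :: "real \<Rightarrow> complex measure \<Rightarrow> real" where
  "cont_energy l M = (\<integral>y. (\<integral>x. cmod (x - y) powr l \<partial>M) \<partial>M)"

definition roots_energy :: "real \<Rightarrow> nat \<Rightarrow> real" where
  "roots_energy l N =
     real N * 2 powr l * (\<Sum>k = 1..N - 1. sin (pi * real k / real N) powr l)"

definition s_term :: "real \<Rightarrow> nat \<Rightarrow> real" where
  "s_term l k =
     (1 + (-1) ^ k / 2 powi (int k - 1)) *
     (roots_energy l (2 ^ k) - 2 ^ (2 * k) * cont_energy l sigma1)"

definition s_const :: "real \<Rightarrow> real" where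
  "s_const l = 1 / 3 * (\<Sum>k. s_term l k)"

definition energy_diff :: "real \<Rightarrow> (nat \<Rightarrow> complex) \<Rightarrow> nat \<Rightarrow> real" where
  "energy_diff l a N = energy l N a - (real N)\<^sup>2 * cont_energy l sigma1"

end

theory Submission
  imports Defs
begin

text \<open>
  Write \<open>m = l/2\<close>, so that \<open>1/2 < m < 1\<close> and chord powers are \<open>\<bar>x - y\<bar> powr l = X powr m\<close> with
  \<open>X = \<bar>x - y\<bar>\<^sup>2 \<in> [0, 4]\<close>.

  \<^bold>\<open>Dyadic blocks.\<close> The power \<open>X powr m\<close> is a positive mixture of the functions
  \<open>X / (X + t) = 1 - t / (X + t)\<close>, \<open>t > 0\<close>. Resolvents are compatible with squaring on the circle: for
  unimodular \<open>z, u\<close> the numbers \<open>X = \<bar>z - u\<bar>\<^sup>2\<close>, \<open>4 - X = \<bar>z + u\<bar>\<^sup>2\<close> and \<open>X * (4 - X) = \<bar>z\<^sup>2 - u\<^sup>2\<bar>\<^sup>2\<close> satisfy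
  \<open>1 / (X + t) + 1 / (4 - X + t) = (4 + 2 * t) / (X * (4 - X) + t * (4 + t))\<close>. Hence the potential at
  \<open>x\<close> of a coset of the \<open>2 ^ i\<close>-th roots of unity is again such a mixture; it depends only on the
  chord between the \<open>2 ^ i\<close>-th powers and is largest exactly when these powers are antipodal. Put
  \<open>M\<^sub>i\<close> for this largest value (\<open>block_potential m i 4\<close>) and \<open>I\<close> for the continuous energy. The same
  representation gives \<open>e\<^sub>i = M\<^sub>i - 2 ^ i * I > 0\<close> (\<open>block_excess\<close>) and, since \<open>m > 1/2\<close>,
  \<open>(\<Sum>i. 2 ^ i * e\<^sub>i) < \<infinity>\<close>.

  \<^bold>\<open>Greedy sequences.\<close> If the first \<open>N\<close> points split along the binary digits of \<open>N\<close> into cosets, each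
  placed antipodally (in the appropriate power) to the larger ones, then a single point maximizes
  the potentials of all these blocks simultaneously, so a greedy choice must do so too and the
  structure persists (\<open>greedy_dyadic_antipodal\<close>). Therefore the potential at the \<open>n\<close>-th greedy point is
  the sum of \<open>M\<^sub>i\<close> over the positions \<open>i\<close> of the digits \<open>1\<close> of \<open>n\<close>. Together with \<open>(\<Sum>i. e\<^sub>i) = I\<close> this yields
  \<open>H(N) - N\<^sup>2 * I = - (\<Sum>i. d\<^sub>i(N) * e\<^sub>i)\<close>, where \<open>d\<^sub>i(N) \<le> 2 ^ i\<close> is the distance from \<open>N\<close> to the nearest multiple
  of \<open>2 ^ (i + 1)\<close> (\<open>energy_diff_eq_excess_series\<close>).

  \<^bold>\<open>Conclusion.\<close> The series is dominated by \<open>2 ^ i * e\<^sub>i\<close>, which gives boundedness and allows passing to the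
  limit termwise (Tannery). The terms are nonpositive and \<open>d\<^sub>i(2 ^ n) = 0\<close> for \<open>i < n\<close>, so the upper limit is
  \<open>0\<close>. As \<open>d\<^sub>i(N + 2 ^ n) = d\<^sub>i(N)\<close> for \<open>i < n\<close>, every term is a limit point, whence the lower limit is the
  infimum and, the term at \<open>2\<close> being negative, the sequence diverges. Finally along the Jacobsthal
  numbers \<open>N = (2 ^ n - (-1) ^ n) / 3\<close>, which keep a distance of about one third of the mesh from every
  dyadic grid of mesh at most \<open>2 ^ n\<close>, \<open>d\<^sub>i(N) = (2 ^ (i + 1) + (-1) ^ i) / 3\<close> for \<open>i < n\<close>,
  and summation by parts identifies the limit as \<open>s_const\<close>.
\<close>

section \<open>Mellin integrals of resolvents\<close>

definition mellin_measure :: "real \<Rightarrow> real measure" where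
  "mellin_measure m = density lborel (\<lambda>t. ennreal (indicator {0<..} t * t powr (m - 1)))"

lemma sets_mellin_measure [measurable_cong, simp]: "sets (mellin_measure m) = sets borel"
  by (simp add: mellin_measure_def)

lemma space_mellin_measure [simp]: "space (mellin_measure m) = UNIV"
  by (simp add: mellin_measure_def)

lemma mellin_measure_integral:
  assumes [measurable]: "h \<in> borel_measurable borel"
  shows "(\<integral>t. h t \<partial>mellin_measure m) = (\<integral>t. (indicator {0<..} t * t powr (m - 1)) * h t \<partial>lborel)"
    and "integrable (mellin_measure m) h
           \<longleftrightarrow> integrable lborel (\<lambda>t. (indicator {0<..} t * t powr (m - 1)) * h t)"
  unfolding mellin_measure_def
  by (subst integral_density integrable_density; simp)+

lemma AE_mellin_measure: "AE t in mellin_measure m. 0 < t"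
proof -
  have "AE t in lborel. 0 < ennreal (indicator {0<..} t * t powr (m - 1)) \<longrightarrow> 0 < t"
    by (rule AE_I2) (auto simp: indicator_def)
  then show ?thesis
    unfolding mellin_measure_def by (subst AE_density) auto
qed

lemma mellin_integral_pos:
  fixes h :: "real \<Rightarrow> real"
  assumes int: "integrable (mellin_measure m) h" and pos: "\<And>t. 0 < t \<Longrightarrow> 0 < h t"
  shows "0 < (\<integral>t. h t \<partial>mellin_measure m)"
proof -
  have [measurable]: "h \<in> borel_measurable borel"
    using borel_measurable_integrable[OF int] by simp
  have nn: "AE t in mellin_measure m. 0 \<le> h t"
    using AE_mellin_measure by eventually_elim (use pos in force)
  have "(\<integral>t. h t \<partial>mellin_measure m) \<noteq> 0"
  proof
    assume "(\<integral>t. h t \<partial>mellin_measure m) = 0"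
    then have "AE t in mellin_measure m. h t = 0"
      using integral_nonneg_eq_0_iff_AE[OF int nn] by simp
    then have "AE t in mellin_measure m. False"
      using AE_mellin_measure by eventually_elim (use pos in force)
    then have "AE t in lborel. 0 < ennreal (indicator {0<..} t * t powr (m - 1)) \<longrightarrow> False"
      unfolding mellin_measure_def by (subst (asm) AE_density) auto
    then have "AE t in lborel. t \<notin> {0<..<1::real}"
      by eventually_elim (auto simp: indicator_def split: if_splits)
    then have "emeasure lborel {0<..<1::real} = 0"
      by (subst (asm) AE_iff_measurable[where N = "{0<..<1}"]) auto
    then show False by simp
  qed
  then show ?thesis
    using integral_nonneg_AE[OF nn] by simp
qed

text \<open>
  Near \<open>0\<close> the density contributes \<open>t powr (m - 1 - b)\<close>, near infinity \<open>t powr (m - 2)\<close>; both are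
  integrable exactly because \<open>b < m < 1\<close>.
\<close>
lemma mellin_integrable:
  fixes h :: "real \<Rightarrow> real"
  assumes [measurable]: "h \<in> borel_measurable borel" and "0 \<le> b" "b < m" "m < 1"
    and small: "\<And>t. 0 < t \<Longrightarrow> t \<le> 1 \<Longrightarrow> \<bar>h t\<bar> \<le> A * t powr (-b)"
    and large: "\<And>t. 1 \<le> t \<Longrightarrow> \<bar>h t\<bar> \<le> A * t powr (-1)"
  shows "integrable (mellin_measure m) h"
proof -
  have A: "0 \<le> A" using large[of 1] by simp
  have near0: "integrable lborel (\<lambda>t. indicator {0..1} t * t powr (m - 1 - b))"
  proof -
    have "(\<lambda>x. x powr (m - 1 - b)) integrable_on {0..1}"
      using has_integral_powr_from_0[of "m - 1 - b" 1] assms by (auto simp: integrable_on_def)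
    then have "(\<lambda>x. x powr (m - 1 - b)) absolutely_integrable_on {0..1}"
      by (intro nonnegative_absolutely_integrable_1) auto
    then show ?thesis
      unfolding set_integrable_def by (subst (asm) integrable_completion) auto
  qed
  have near_inf: "integrable lborel (\<lambda>t. indicator {1..} t * t powr (m - 2))"
  proof -
    have "(\<lambda>x. x powr (m - 2)) integrable_on {1..}"
      using has_integral_powr_to_inf[of "m - 2" 1] assms by (auto simp: integrable_on_def)
    then have "(\<lambda>x. x powr (m - 2)) absolutely_integrable_on {1..}"
      by (intro nonnegative_absolutely_integrable_1) auto
    then show ?thesis
      unfolding set_integrable_def by (subst (asm) integrable_completion) auto
  qed
  show ?thesis
  proof (subst mellin_measure_integral, measurable, rule Bochner_Integration.integrable_bound)
    show "integrable lborel (\<lambda>t. A * (indicator {0..1} t * t powr (m - 1 - b))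
            + A * (indicator {1..} t * t powr (m - 2)))"
      by (intro Bochner_Integration.integrable_add integrable_mult_right near0 near_inf)
    show "AE t in lborel. norm ((indicator {0<..} t * t powr (m - 1)) * h t)
       \<le> norm (A * (indicator {0..1} t * t powr (m - 1 - b)) + A * (indicator {1..} t * t powr (m - 2)))"
    proof (rule AE_I2)
      fix t :: real
      show "norm ((indicator {0<..} t * t powr (m - 1)) * h t)
       \<le> norm (A * (indicator {0..1} t * t powr (m - 1 - b)) + A * (indicator {1..} t * t powr (m - 2)))"
      proof (cases "0 < t")
        case False
        then show ?thesis by simp
      next
        case pos: True
        show ?thesis
        proof (cases "t \<le> 1")
          case True
          have "t powr (m - 1) * \<bar>h t\<bar> \<le> t powr (m - 1) * (A * t powr (-b))"
            by (intro mult_left_mono small pos True) auto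
          also have "\<dots> = A * t powr (m - 1 - b)"
            using pos by (simp flip: powr_add)
          also have "\<dots> \<le> A * t powr (m - 1 - b) + A * (indicator {1..} t * t powr (m - 2))"
            using A by simp
          finally show ?thesis using pos True A by (simp add: abs_mult)
        next
          case False
          have "t powr (m - 1) * \<bar>h t\<bar> \<le> t powr (m - 1) * (A * t powr (-1))"
            using False by (intro mult_left_mono large) auto
          also have "\<dots> = A * t powr (m - 2)"
            using pos by (simp add: powr_diff powr_minus field_simps power2_eq_square)
          finally show ?thesis using pos False A by (simp add: abs_mult)
        qed
      qed
    qed
  qed auto
qed

lemma integrable_resolvent:
  assumes "0 < m" "m < 1" "0 < c"
  shows "integrable (mellin_measure m) (\<lambda>t. 1 / (c + t))"
proof (rule mellin_integrable[where b = 0 and A = "1 / c + 1"])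
  fix t :: real assume t: "0 < t" "t \<le> 1"
  have "\<bar>1 / (c + t)\<bar> \<le> 1 / c"
    using t assms by (simp add: frac_le)
  then show "\<bar>1 / (c + t)\<bar> \<le> (1 / c + 1) * t powr - 0"
    using t by simp
next
  fix t :: real assume t: "1 \<le> t"
  have "\<bar>1 / (c + t)\<bar> \<le> 1 * t powr (-1)"
    using t assms by (simp add: powr_minus_divide frac_le)
  also have "\<dots> \<le> (1 / c + 1) * t powr (-1)"
    by (intro mult_right_mono) (use assms in auto)
  finally show "\<bar>1 / (c + t)\<bar> \<le> (1 / c + 1) * t powr (-1)" .
qed (use assms in auto)

text \<open>
  The substitution \<open>t = x * s\<close> pulls out the power of \<open>x\<close> and leaves a Beta integral as a factor. After
  division by it, \<open>x powr m\<close> is a positive mixture of the functions \<open>x / (x + t)\<close>.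
\<close>
lemma resolvent_moment_scaling:
  assumes "0 < m" "m < 1" "0 \<le> x"
  shows "(\<integral>t. x / (x + t) \<partial>mellin_measure m)
           = x powr m * (\<integral>t. 1 / (1 + t) \<partial>mellin_measure m)"
proof (cases "x = 0")
  case False
  then have x: "0 < x" using assms by simp
  have "(\<integral>t. x / (x + t) \<partial>mellin_measure m)
      = (\<integral>t. (indicator {0<..} t * t powr (m - 1)) * (x / (x + t)) \<partial>lborel)"
    by (rule mellin_measure_integral) measurable
  also have "\<dots> = \<bar>x\<bar> *\<^sub>R (\<integral>s. (indicator {0<..} (0 + x * s) * (0 + x * s) powr (m - 1))
                                * (x / (x + (0 + x * s))) \<partial>lborel)"
    using x by (intro lborel_integral_real_affine) auto
  also have "\<dots> = (\<integral>s. x powr m * ((indicator {0<..} s * s powr (m - 1)) * (1 / (1 + s))) \<partial>lborel)"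
    unfolding integral_scaleR_right[symmetric]
  proof (intro Bochner_Integration.integral_cong refl)
    fix s :: real
    show "\<bar>x\<bar> *\<^sub>R ((indicator {0<..} (0 + x * s) * (0 + x * s) powr (m - 1)) * (x / (x + (0 + x * s))))
        = x powr m * ((indicator {0<..} s * s powr (m - 1)) * (1 / (1 + s)))"
    proof (cases "0 < s")
      case True
      have "x + x * s = x * (1 + s)" by (simp add: algebra_simps)
      then have "x / (x + x * s) = 1 / (1 + s)"
        using x by simp
      moreover have "x * (x * s) powr (m - 1) = x powr m * s powr (m - 1)"
        using x True by (simp add: powr_mult powr_diff)
      ultimately show ?thesis using x True by (simp add: indicator_def)
    next
      case False
      then show ?thesis using x by (simp add: indicator_def zero_less_mult_iff)
    qed
  qed
  also have "\<dots> = x powr m * (\<integral>t. 1 / (1 + t) \<partial>mellin_measure m)"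
    unfolding integral_mult_right_zero by (subst mellin_measure_integral(1)) simp_all
  finally show ?thesis .
qed simp

text \<open>
  The mean over the unit circle of \<open>1 / (\<bar>x - 1\<bar>\<^sup>2 + t)\<close>, that is, the Stieltjes transform of the arcsine law
  on \<open>[0, 4]\<close>.
\<close>
definition arcsine_factor :: "real \<Rightarrow> real" where
  "arcsine_factor t = 1 / sqrt (t * (t + 4))"

lemma arcsine_factor_measurable [measurable]: "arcsine_factor \<in> borel_measurable borel"
  unfolding arcsine_factor_def by measurable

lemma arcsine_factor_pos: "0 < t \<Longrightarrow> 0 < arcsine_factor t"
  by (simp add: arcsine_factor_def)

text \<open>
  Since the factor behaves like \<open>t powr (-1/2)\<close> at \<open>0\<close>, this is where the hypothesis \<open>l > 1\<close> enters.
\<close>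
lemma integrable_arcsine_factor:
  assumes "1/2 < m" "m < 1"
  shows "integrable (mellin_measure m) arcsine_factor"
proof (rule mellin_integrable[where b = "1/2" and A = 1])
  fix t :: real assume t: "0 < t" "t \<le> 1"
  have "sqrt t \<le> sqrt (t * (t + 4))" using t by (intro real_sqrt_le_mono) auto
  then show "\<bar>arcsine_factor t\<bar> \<le> 1 * t powr - (1 / 2)"
    using t by (simp add: arcsine_factor_def powr_minus_divide powr_half_sqrt frac_le)
next
  fix t :: real assume t: "1 \<le> t"
  have "sqrt (t * t) \<le> sqrt (t * (t + 4))"
    by (intro real_sqrt_le_mono mult_left_mono) (use t in auto)
  then have "t \<le> sqrt (t * (t + 4))" using t by simp
  then have "1 / sqrt (t * (t + 4)) \<le> 1 / t"
    using t by (intro divide_left_mono) auto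
  then show "\<bar>arcsine_factor t\<bar> \<le> 1 * t powr (- 1)"
    using t by (simp add: arcsine_factor_def powr_minus_divide)
qed (use assms in auto)

section \<open>Dyadic blocks as mixtures of resolvents\<close>

text \<open>
  The sum of \<open>1 / (\<bar>x - y\<bar>\<^sup>2 + t)\<close> over a coset of the \<open>2 ^ i\<close>-th roots of unity is again of this form, with
  numerator \<open>resolvent_weight i t\<close>, shift \<open>resolvent_shift i t\<close>, and the points replaced by their \<open>2 ^ i\<close>-th
  powers. The recursions come from adding the contributions of two antipodal cosets.
\<close>
fun resolvent_shift :: "nat \<Rightarrow> real \<Rightarrow> real" where
  "resolvent_shift 0 t = t"
| "resolvent_shift (Suc i) t = resolvent_shift i t * (4 + resolvent_shift i t)"

fun resolvent_weight :: "nat \<Rightarrow> real \<Rightarrow> real" where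
  "resolvent_weight 0 t = 1"
| "resolvent_weight (Suc i) t = resolvent_weight i t * (4 + 2 * resolvent_shift i t)"

definition shift_root :: "nat \<Rightarrow> real \<Rightarrow> real" where
  "shift_root i t = sqrt (resolvent_shift i t * (resolvent_shift i t + 4))"

lemma resolvent_shift_measurable [measurable]: "resolvent_shift i \<in> borel_measurable borel"
proof (induction i)
  case 0
  have "resolvent_shift 0 = (\<lambda>t. t)" by auto
  then show ?case by simp
next
  case (Suc i)
  note [measurable] = Suc
  have "resolvent_shift (Suc i) = (\<lambda>t. resolvent_shift i t * (4 + resolvent_shift i t))" by auto
  then show ?case by simp
qed

lemma resolvent_weight_measurable [measurable]: "resolvent_weight i \<in> borel_measurable borel"
proof (induction i)
  case 0
  have "resolvent_weight 0 = (\<lambda>t. 1)" by auto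
  then show ?case by simp
next
  case (Suc i)
  note [measurable] = Suc
  have "resolvent_weight (Suc i) = (\<lambda>t. resolvent_weight i t * (4 + 2 * resolvent_shift i t))"
    by auto
  then show ?case by simp
qed

lemma shift_root_measurable [measurable]: "shift_root i \<in> borel_measurable borel"
  unfolding shift_root_def by measurable

lemma resolvent_shift_pos: "0 < t \<Longrightarrow> 0 < resolvent_shift i t"
  by (induction i) (auto simp: add_pos_pos)

lemma resolvent_shift_ge: "0 < t \<Longrightarrow> 4 ^ i * t \<le> resolvent_shift i t"
proof (induction i)
  case (Suc i)
  have "4 ^ Suc i * t = (4 ^ i * t) * 4" by simp
  also have "\<dots> \<le> resolvent_shift i t * (4 + resolvent_shift i t)"
    using Suc resolvent_shift_pos[of t i] by (intro mult_mono) auto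
  finally show ?case by simp
qed simp

lemma shift_root_bounds:
  assumes "0 < t"
  shows "resolvent_shift i t \<le> shift_root i t" and "shift_root i t < resolvent_shift i t + 2"
proof -
  note pos = resolvent_shift_pos[OF assms, of i]
  show "resolvent_shift i t \<le> shift_root i t"
    unfolding shift_root_def using pos by (intro real_le_rsqrt) (simp add: power2_eq_square)
  show "shift_root i t < resolvent_shift i t + 2"
    unfolding shift_root_def using pos
    by (intro real_less_lsqrt) (auto simp: power2_eq_square algebra_simps)
qed

text \<open>
  The quantity under the root in \<open>shift_root\<close> gains the square factor \<open>(s + 2)\<^sup>2\<close> in each step, and the
  weight gains \<open>2 * (s + 2)\<close>, so their quotient just doubles.
\<close>
lemma resolvent_weight_eq:
  assumes "0 < t"
  shows "resolvent_weight i t = 2 ^ i * arcsine_factor t * shift_root i t"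
proof (induction i)
  case 0
  then show ?case using assms by (simp add: arcsine_factor_def shift_root_def)
next
  case (Suc i)
  define s where "s = resolvent_shift i t"
  have s: "0 < s" using resolvent_shift_pos[OF assms] by (simp add: s_def)
  have "resolvent_shift (Suc i) t * (resolvent_shift (Suc i) t + 4) = (s + 2)\<^sup>2 * (s * (s + 4))"
    by (simp add: s_def[symmetric] power2_eq_square algebra_simps)
  then have "shift_root (Suc i) t = sqrt ((s + 2)\<^sup>2 * (s * (s + 4)))"
    by (simp only: shift_root_def)
  also have "\<dots> = (s + 2) * shift_root i t"
    using s by (simp add: shift_root_def real_sqrt_mult s_def[symmetric])
  finally have "shift_root (Suc i) t = (s + 2) * shift_root i t" .
  then show ?case using Suc by (simp add: s_def algebra_simps)
qed

text \<open>
  The integrand of the potential of a block of \<open>2 ^ i\<close> points, split into its average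
  \<open>2 ^ i * mean_kernel t\<close> over the circle and the deviation \<open>block_deviation i X t\<close> from that average.
\<close>
definition block_kernel :: "nat \<Rightarrow> real \<Rightarrow> real \<Rightarrow> real" where
  "block_kernel i X t = 2 ^ i - t * resolvent_weight i t / (X + resolvent_shift i t)"

definition mean_kernel :: "real \<Rightarrow> real" where
  "mean_kernel t = 1 - t * arcsine_factor t"

definition block_deviation :: "nat \<Rightarrow> real \<Rightarrow> real \<Rightarrow> real" where
  "block_deviation i X t =
     2 ^ i * (t * arcsine_factor t) * (1 - shift_root i t / (X + resolvent_shift i t))"

lemma kernel_measurable [measurable]:
  "block_kernel i X \<in> borel_measurable borel"
  "mean_kernel \<in> borel_measurable borel"
  "block_deviation i X \<in> borel_measurable borel"
  unfolding block_kernel_def mean_kernel_def block_deviation_def by measurable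

lemma block_kernel_split:
  "0 < t \<Longrightarrow> block_kernel i X t = 2 ^ i * mean_kernel t + block_deviation i X t"
  by (simp add: block_kernel_def mean_kernel_def block_deviation_def resolvent_weight_eq algebra_simps)

lemma block_deviation_bound:
  assumes "0 < t" "0 \<le> X" "X \<le> 4"
  shows "\<bar>block_deviation i X t\<bar> \<le> 4 / 2 ^ i * arcsine_factor t"
proof -
  define s where "s = resolvent_shift i t"
  note s = resolvent_shift_pos[OF assms(1), of i, folded s_def]
  note b = shift_root_bounds[OF assms(1), of i, folded s_def]
  have "1 - shift_root i t / (X + s) = (X + s - shift_root i t) / (X + s)"
    using s assms by (simp add: diff_divide_distrib)
  then have "\<bar>1 - shift_root i t / (X + s)\<bar> = \<bar>X + s - shift_root i t\<bar> / (X + s)"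
    using s assms by (simp only: abs_divide)
  also have "\<dots> \<le> 4 / s"
    using s assms b by (intro frac_le) auto
  also have "\<dots> \<le> 4 / (4 ^ i * t)"
    using s assms resolvent_shift_ge[OF assms(1), of i] by (intro divide_left_mono) (auto simp: s_def)
  finally have 1: "\<bar>1 - shift_root i t / (X + s)\<bar> \<le> 4 / (4 ^ i * t)" .
  have "\<bar>block_deviation i X t\<bar>
      = 2 ^ i * (t * arcsine_factor t) * \<bar>1 - shift_root i t / (X + s)\<bar>"
    using assms arcsine_factor_pos[of t] by (simp add: block_deviation_def s_def abs_mult)
  also have "\<dots> \<le> 2 ^ i * (t * arcsine_factor t) * (4 / (4 ^ i * t))"
    using assms arcsine_factor_pos[of t] by (intro mult_left_mono 1) auto
  also have "\<dots> = 4 / 2 ^ i * arcsine_factor t"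
  proof -
    have "(4::real) ^ i = 2 ^ i * 2 ^ i" by (simp flip: power_mult_distrib)
    then show ?thesis using assms by (simp add: field_simps)
  qed
  finally show ?thesis .
qed

text \<open>
  The sum telescopes, because \<open>1 / (s + 4) = 1 / s - 4 / (s * (4 + s))\<close> and \<open>s * (4 + s)\<close> is the next shift.
\<close>
lemma sum_resolvent_eq:
  "0 < t \<Longrightarrow> (\<Sum>i<K. 4 ^ i / (resolvent_shift i t + 4)) = 1 / t - 4 ^ K / resolvent_shift K t"
proof (induction K)
  case (Suc K)
  define s where "s = resolvent_shift K t"
  have s: "0 < s" using resolvent_shift_pos[OF Suc.prems] by (simp add: s_def)
  have "4 ^ K / (s + 4) - 4 ^ K / s = - (4 ^ Suc K / (s * (4 + s)))"
    using s by (simp add: divide_simps) (simp add: algebra_simps)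
  then show ?case using Suc by (simp add: s_def)
qed simp

lemma block_deviation_top_pos:
  assumes "0 < t"
  shows "0 < block_deviation i 4 t"
  using assms shift_root_bounds[OF assms, of i] resolvent_shift_pos[OF assms, of i] arcsine_factor_pos[of t]
  by (simp add: block_deviation_def)

text \<open>
  Summing with weights \<open>2 ^ i\<close> costs only a factor \<open>1 / t\<close>, which turns \<open>t * arcsine_factor t\<close> into the still
  integrable \<open>arcsine_factor t\<close>. A termwise bound by \<open>block_deviation_bound\<close> would lose all decay here.
\<close>
lemma sum_block_deviation_top_le:
  assumes "0 < t"
  shows "(\<Sum>i<K. 2 ^ i * block_deviation i 4 t) \<le> 4 * arcsine_factor t"
proof -
  note q = arcsine_factor_pos[OF assms]
  have "2 ^ i * block_deviation i 4 t
        \<le> 4 * t * arcsine_factor t * (4 ^ i / (resolvent_shift i t + 4))" for i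
  proof -
    note s = resolvent_shift_pos[OF assms, of i]
    note b = shift_root_bounds[OF assms, of i]
    have "1 - shift_root i t / (4 + resolvent_shift i t) \<le> 4 / (resolvent_shift i t + 4)"
      using s b by (subst diff_divide_eq_iff) (auto intro!: frac_le)
    then have "(4 ^ i * (t * arcsine_factor t)) * (1 - shift_root i t / (4 + resolvent_shift i t))
        \<le> (4 ^ i * (t * arcsine_factor t)) * (4 / (resolvent_shift i t + 4))"
      using assms q by (intro mult_left_mono) auto
    moreover have "2 ^ i * block_deviation i 4 t
        = (4 ^ i * (t * arcsine_factor t)) * (1 - shift_root i t / (4 + resolvent_shift i t))"
      unfolding block_deviation_def by (simp flip: mult.assoc power_mult_distrib)
    ultimately show ?thesis by (simp add: mult_ac)
  qed
  then have "(\<Sum>i<K. 2 ^ i * block_deviation i 4 t)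
      \<le> (\<Sum>i<K. 4 * t * arcsine_factor t * (4 ^ i / (resolvent_shift i t + 4)))"
    by (intro sum_mono)
  also have "\<dots> = 4 * t * arcsine_factor t * (1 / t - 4 ^ K / resolvent_shift K t)"
    by (simp only: sum_distrib_left[symmetric] sum_resolvent_eq[OF assms])
  also have "\<dots> \<le> 4 * t * arcsine_factor t * (1 / t)"
    using assms q resolvent_shift_pos[OF assms, of K] by (intro mult_left_mono) auto
  finally show ?thesis using assms by simp
qed

definition resolvent_constant :: "real \<Rightarrow> real" where
  "resolvent_constant m = (\<integral>t. 1 / (1 + t) \<partial>mellin_measure m)"

text \<open>
  The potential created at a point \<open>x\<close> by a coset of the \<open>2 ^ i\<close>-th roots of unity, as a function of the
  squared chord \<open>X\<close> between the \<open>2 ^ i\<close>-th powers of \<open>x\<close> and of the coset. Thus \<open>X = 0\<close> at the points of the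
  coset and \<open>X = 4\<close> halfway between neighbouring points.
\<close>
definition block_potential :: "real \<Rightarrow> nat \<Rightarrow> real \<Rightarrow> real" where
  "block_potential m i X = (\<integral>t. block_kernel i X t \<partial>mellin_measure m) / resolvent_constant m"

definition mean_potential :: "real \<Rightarrow> real" where
  "mean_potential m = (\<integral>t. mean_kernel t \<partial>mellin_measure m) / resolvent_constant m"

text \<open>
  How much the potential halfway between equally spaced points exceeds its average over the circle.
\<close>
definition block_excess :: "real \<Rightarrow> nat \<Rightarrow> real" where
  "block_excess m i = block_potential m i 4 - 2 ^ i * mean_potential m"

lemma resolvent_constant_pos: "0 < m \<Longrightarrow> m < 1 \<Longrightarrow> 0 < resolvent_constant m"
  unfolding resolvent_constant_def by (intro mellin_integral_pos integrable_resolvent) auto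

context
  fixes m :: real
  assumes m: "1/2 < m" "m < 1"
begin

lemma integrable_block_deviation:
  assumes "0 \<le> X" "X \<le> 4"
  shows "integrable (mellin_measure m) (block_deviation i X)"
proof (rule Bochner_Integration.integrable_bound)
  show "integrable (mellin_measure m) (\<lambda>t. 4 / 2 ^ i * arcsine_factor t)"
    by (intro integrable_mult_right integrable_arcsine_factor m)
  show "AE t in mellin_measure m. norm (block_deviation i X t) \<le> norm (4 / 2 ^ i * arcsine_factor t)"
    using AE_mellin_measure
  proof eventually_elim
    case (elim t)
    have "norm (block_deviation i X t) \<le> 4 / 2 ^ i * arcsine_factor t"
      using block_deviation_bound[OF elim assms] by simp
    also have "\<dots> \<le> norm (4 / 2 ^ i * arcsine_factor t)"
      unfolding real_norm_def by (rule abs_ge_self)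
    finally show ?case .
  qed
qed simp

lemma integrable_mean_kernel: "integrable (mellin_measure m) mean_kernel"
proof -
  have "integrable (mellin_measure m) (\<lambda>t. 4 * (1 / (4 + t)) - block_deviation 0 4 t)"
    by (intro Bochner_Integration.integrable_diff integrable_mult_right integrable_resolvent
          integrable_block_deviation) (use m in auto)
  moreover have "AE t in mellin_measure m. 4 * (1 / (4 + t)) - block_deviation 0 4 t = mean_kernel t"
    using AE_mellin_measure
  proof eventually_elim
    case (elim t)
    have "block_kernel 0 4 t = 4 * (1 / (4 + t))"
      using elim by (simp add: block_kernel_def field_simps)
    then show ?case using block_kernel_split[OF elim, of 0 4] by simp
  qed
  ultimately show ?thesis
    by (subst integrable_cong_AE[symmetric]) auto
qed

lemma integrable_block_kernel:
  assumes "0 \<le> X" "X \<le> 4"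
  shows "integrable (mellin_measure m) (block_kernel i X)"
proof -
  have "integrable (mellin_measure m) (\<lambda>t. 2 ^ i * mean_kernel t + block_deviation i X t)"
    by (intro Bochner_Integration.integrable_add integrable_mult_right integrable_mean_kernel
          integrable_block_deviation assms)
  moreover have "AE t in mellin_measure m. 2 ^ i * mean_kernel t + block_deviation i X t = block_kernel i X t"
    using AE_mellin_measure by eventually_elim (simp add: block_kernel_split)
  ultimately show ?thesis
    by (subst integrable_cong_AE[symmetric]) auto
qed

lemma block_potential_deviation:
  assumes "0 \<le> X" "X \<le> 4"
  shows "block_potential m i X - 2 ^ i * mean_potential m
           = (\<integral>t. block_deviation i X t \<partial>mellin_measure m) / resolvent_constant m"
proof -
  have "(\<integral>t. block_kernel i X t \<partial>mellin_measure m)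
      = (\<integral>t. 2 ^ i * mean_kernel t + block_deviation i X t \<partial>mellin_measure m)"
  proof (intro integral_cong_AE)
    show "AE t in mellin_measure m. block_kernel i X t = 2 ^ i * mean_kernel t + block_deviation i X t"
      using AE_mellin_measure by eventually_elim (simp add: block_kernel_split)
  qed auto
  also have "\<dots> = 2 ^ i * (\<integral>t. mean_kernel t \<partial>mellin_measure m)
                 + (\<integral>t. block_deviation i X t \<partial>mellin_measure m)"
    using integrable_mean_kernel integrable_block_deviation[OF assms]
    by (subst Bochner_Integration.integral_add) auto
  finally show ?thesis
    by (simp add: block_potential_def mean_potential_def add_divide_distrib)
qed

lemma block_potential_0:
  assumes "0 \<le> X" "X \<le> 4"
  shows "block_potential m 0 X = X powr m"
proof -
  have "(\<integral>t. block_kernel 0 X t \<partial>mellin_measure m) = (\<integral>t. X / (X + t) \<partial>mellin_measure m)"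
  proof (intro integral_cong_AE)
    show "AE t in mellin_measure m. block_kernel 0 X t = X / (X + t)"
      using AE_mellin_measure
      by eventually_elim (use assms in \<open>simp add: block_kernel_def field_simps\<close>)
  qed auto
  then show ?thesis
    using resolvent_moment_scaling[of m X] m assms resolvent_constant_pos[of m]
    by (simp add: block_potential_def resolvent_constant_def)
qed

text \<open>
  Partial fractions: \<open>X * (4 - X) + s * (4 + s) = (X + s) * (4 - X + s)\<close>.
\<close>
lemma block_potential_Suc:
  assumes "0 \<le> X" "X \<le> 4"
  shows "block_potential m (Suc i) (X * (4 - X)) = block_potential m i X + block_potential m i (4 - X)"
proof -
  have "(\<integral>t. block_kernel (Suc i) (X * (4 - X)) t \<partial>mellin_measure m)
      = (\<integral>t. block_kernel i X t + block_kernel i (4 - X) t \<partial>mellin_measure m)"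
  proof (intro integral_cong_AE)
    show "AE t in mellin_measure m.
        block_kernel (Suc i) (X * (4 - X)) t = block_kernel i X t + block_kernel i (4 - X) t"
      using AE_mellin_measure
    proof eventually_elim
      case (elim t)
      define s where "s = resolvent_shift i t"
      note s = resolvent_shift_pos[OF elim, of i, folded s_def]
      have "X * (4 - X) + s * (4 + s) = (X + s) * (4 - X + s)" by (simp add: algebra_simps)
      moreover have "1 / (X + s) + 1 / (4 - X + s) = (4 + 2 * s) / ((X + s) * (4 - X + s))"
        using s assms by (simp add: divide_simps)
      ultimately have "(4 + 2 * s) / (X * (4 - X) + s * (4 + s)) = 1 / (X + s) + 1 / (4 - X + s)"
        by simp
      then have "t * resolvent_weight i t * ((4 + 2 * s) / (X * (4 - X) + s * (4 + s)))
          = t * resolvent_weight i t * (1 / (X + s) + 1 / (4 - X + s))" by simp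
      then show ?case
        by (simp add: block_kernel_def s_def[symmetric] distrib_left mult.assoc)
    qed
  qed auto
  also have "\<dots> = (\<integral>t. block_kernel i X t \<partial>mellin_measure m)
                 + (\<integral>t. block_kernel i (4 - X) t \<partial>mellin_measure m)"
    using assms by (intro Bochner_Integration.integral_add integrable_block_kernel) auto
  finally show ?thesis by (simp add: block_potential_def add_divide_distrib)
qed

lemma block_potential_less_top:
  assumes "0 \<le> X" "X < 4"
  shows "block_potential m i X < block_potential m i 4"
proof -
  have "0 < (\<integral>t. block_kernel i 4 t - block_kernel i X t \<partial>mellin_measure m)"
  proof (rule mellin_integral_pos)
    show "integrable (mellin_measure m) (\<lambda>t. block_kernel i 4 t - block_kernel i X t)"
      using assms by (intro Bochner_Integration.integrable_diff integrable_block_kernel) auto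
    fix t :: real assume t: "0 < t"
    note s = resolvent_shift_pos[OF t, of i]
    have "0 < resolvent_weight i t"
      using t shift_root_bounds[OF t, of i] s arcsine_factor_pos[OF t]
      by (simp add: resolvent_weight_eq)
    then have "t * resolvent_weight i t / (4 + resolvent_shift i t)
        < t * resolvent_weight i t / (X + resolvent_shift i t)"
      using s assms t by (intro divide_strict_left_mono) auto
    then show "0 < block_kernel i 4 t - block_kernel i X t"
      by (simp add: block_kernel_def)
  qed
  also have "\<dots> = (\<integral>t. block_kernel i 4 t \<partial>mellin_measure m)
                 - (\<integral>t. block_kernel i X t \<partial>mellin_measure m)"
    using assms by (intro Bochner_Integration.integral_diff integrable_block_kernel) auto
  finally show ?thesis
    using resolvent_constant_pos[of m] m by (simp add: block_potential_def divide_strict_right_mono)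
qed

text \<open>
  Uniformity in \<open>X\<close> makes sums over \<open>2 ^ i\<close> equally spaced points computable to within \<open>C / 2 ^ i\<close>, which
  will identify \<open>mean_potential m\<close> as the average of the potential over the circle.
\<close>
lemma block_potential_near_mean:
  "\<exists>C\<ge>0. \<forall>i. \<forall>X\<in>{0..4}. \<bar>block_potential m i X - 2 ^ i * mean_potential m\<bar> \<le> C / 2 ^ i"
proof (intro exI conjI allI ballI)
  define C where "C = 4 * (\<integral>t. arcsine_factor t \<partial>mellin_measure m) / resolvent_constant m"
  note k = resolvent_constant_pos[of m]
  have "0 < (\<integral>t. arcsine_factor t \<partial>mellin_measure m)"
    by (intro mellin_integral_pos integrable_arcsine_factor m arcsine_factor_pos)
  then show "0 \<le> C" unfolding C_def using k m by simp
  fix i :: nat and X :: real assume "X \<in> {0..4}"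
  then have X: "0 \<le> X" "X \<le> 4" by auto
  have "\<bar>\<integral>t. block_deviation i X t \<partial>mellin_measure m\<bar>
      \<le> (\<integral>t. \<bar>block_deviation i X t\<bar> \<partial>mellin_measure m)"
    by (rule integral_abs_bound)
  also have "\<dots> \<le> (\<integral>t. 4 / 2 ^ i * arcsine_factor t \<partial>mellin_measure m)"
  proof (intro integral_mono_AE)
    show "AE t in mellin_measure m. \<bar>block_deviation i X t\<bar> \<le> 4 / 2 ^ i * arcsine_factor t"
      using AE_mellin_measure by eventually_elim (intro block_deviation_bound X)
  qed (auto intro!: integrable_block_deviation integrable_arcsine_factor X m)
  also have "\<dots> = 4 / 2 ^ i * (\<integral>t. arcsine_factor t \<partial>mellin_measure m)"
    by simp
  finally have "\<bar>\<integral>t. block_deviation i X t \<partial>mellin_measure m\<bar> / resolvent_constant m \<le> C / 2 ^ i"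
    using k m by (simp add: C_def divide_simps mult_ac)
  then show "\<bar>block_potential m i X - 2 ^ i * mean_potential m\<bar> \<le> C / 2 ^ i"
    using k m by (simp only: block_potential_deviation[OF X]) (simp add: abs_divide)
qed

lemma block_excess_pos: "0 < block_excess m i"
proof -
  have "0 < (\<integral>t. block_deviation i 4 t \<partial>mellin_measure m)"
    by (intro mellin_integral_pos integrable_block_deviation block_deviation_top_pos) auto
  then show ?thesis
    using resolvent_constant_pos[of m] m by (simp add: block_excess_def block_potential_deviation)
qed

lemma summable_block_excess: "summable (\<lambda>i. 2 ^ i * block_excess m i)"
proof (rule summableI_nonneg_bounded)
  note k = resolvent_constant_pos[of m]
  show "0 \<le> 2 ^ i * block_excess m i" for i
    using block_excess_pos[of i] by simp
  fix K
  have "(\<Sum>i<K. 2 ^ i * block_excess m i)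
      = (\<Sum>i<K. (\<integral>t. 2 ^ i * block_deviation i 4 t \<partial>mellin_measure m)) / resolvent_constant m"
    by (simp add: block_excess_def block_potential_deviation sum_divide_distrib)
  moreover have "(\<Sum>i<K. (\<integral>t. 2 ^ i * block_deviation i 4 t \<partial>mellin_measure m))
      = (\<integral>t. (\<Sum>i<K. 2 ^ i * block_deviation i 4 t) \<partial>mellin_measure m)"
    by (intro Bochner_Integration.integral_sum[symmetric] integrable_mult_right integrable_block_deviation) auto
  moreover have "\<dots> \<le> (\<integral>t. 4 * arcsine_factor t \<partial>mellin_measure m)"
  proof (intro integral_mono_AE)
    show "AE t in mellin_measure m. (\<Sum>i<K. 2 ^ i * block_deviation i 4 t) \<le> 4 * arcsine_factor t"
      using AE_mellin_measure by eventually_elim (rule sum_block_deviation_top_le)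
  qed (auto intro!: Bochner_Integration.integrable_sum integrable_mult_right
         integrable_block_deviation integrable_arcsine_factor m)
  moreover have "0 \<le> resolvent_constant m" using k m by simp
  ultimately show "(\<Sum>i<K. 2 ^ i * block_excess m i)
      \<le> (\<integral>t. 4 * arcsine_factor t \<partial>mellin_measure m) / resolvent_constant m"
    by (simp only: divide_right_mono)
qed

end

section \<open>Chord sums and the continuous energy\<close>

text \<open>
  The parallelogram law; it translates squaring on the circle into the map \<open>X \<mapsto> X * (4 - X)\<close> on squared chords.
\<close>
lemma chord_antipode:
  assumes "cmod z = 1" "cmod u = 1"
  shows "(cmod (z + u))\<^sup>2 = 4 - (cmod (z - u))\<^sup>2"
    and "(cmod (z\<^sup>2 - u\<^sup>2))\<^sup>2 = (cmod (z - u))\<^sup>2 * (4 - (cmod (z - u))\<^sup>2)"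
    and "(cmod (z - u))\<^sup>2 \<le> 4"
proof -
  have "(cmod (z + u))\<^sup>2 + (cmod (z - u))\<^sup>2 = 2 * (cmod z)\<^sup>2 + 2 * (cmod u)\<^sup>2"
    unfolding cmod_power2 by (simp add: power2_eq_square algebra_simps)
  then show 1: "(cmod (z + u))\<^sup>2 = 4 - (cmod (z - u))\<^sup>2" using assms by simp
  have "z\<^sup>2 - u\<^sup>2 = (z - u) * (z + u)" by (simp add: power2_eq_square algebra_simps)
  then show "(cmod (z\<^sup>2 - u\<^sup>2))\<^sup>2 = (cmod (z - u))\<^sup>2 * (4 - (cmod (z - u))\<^sup>2)"
    by (simp add: norm_mult power_mult_distrib 1)
  show "(cmod (z - u))\<^sup>2 \<le> 4" using 1 zero_le_power2[of "cmod (z + u)"] by linarith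
qed

lemma chord_max_iff:
  assumes "cmod z = 1" "cmod u = 1"
  shows "(cmod (z - u))\<^sup>2 = 4 \<longleftrightarrow> z = - u"
  using chord_antipode(1)[OF assms] by (auto simp: eq_neg_iff_add_eq_0)

lemma sum_even_odd_split:
  fixes f :: "nat \<Rightarrow> 'a::comm_monoid_add"
  shows "(\<Sum>j<2 * n. f j) = (\<Sum>j<n. f (2 * j)) + (\<Sum>j<n. f (2 * j + 1))"
  by (induction n) (auto simp: ac_simps)

lemma integral_split_equal_pieces:
  fixes g :: "real \<Rightarrow> real"
  assumes "continuous_on UNIV g" "0 \<le> h"
  shows "integral {0..real n * h} g = integral {0..h} (\<lambda>s. \<Sum>j<n. g (s + real j * h))"
proof -
  have int: "g integrable_on {a..b}" for a b
    using assms by (intro integrable_continuous_interval continuous_on_subset[OF assms(1)]) auto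
  have shift: "continuous_on A (\<lambda>s. g (s + c))" for A c
    by (intro continuous_on_compose2[OF assms(1)] continuous_intros) auto
  show ?thesis
  proof (induction n)
    case (Suc n)
    have "integral {0..real (Suc n) * h} g
        = integral {0..real n * h} g + integral {real n * h..real (Suc n) * h} g"
      using assms by (intro Henstock_Kurzweil_Integration.integral_combine[symmetric] int)
        (auto intro: mult_right_mono)
    also have "integral {real n * h..real (Suc n) * h} g = integral {0..h} (\<lambda>s. g (s + real n * h))"
      using integral_shift_real_ivl[of "real n * h" "real n * h" "real (Suc n) * h" g]
      by (simp add: algebra_simps)
    finally show ?case
      using Suc by (simp add: Henstock_Kurzweil_Integration.integral_add integrable_sum
         integrable_continuous_interval shift)
  qed simp
qed

lemma integral_uniform_arc:
  fixes h :: "real \<Rightarrow> real"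
  assumes "continuous_on UNIV h"
  shows "(\<integral>t. h t \<partial>uniform_measure lborel {0..<2 * pi}) = integral {0..2 * pi} h / (2 * pi)"
proof -
  have [measurable]: "h \<in> borel_measurable borel"
    using assms by (rule borel_measurable_continuous_onI)
  have "uniform_measure lborel {0..<2 * pi}
      = density lborel (\<lambda>t. ennreal (indicator {0..<2 * pi} t / (2 * pi)))"
    unfolding uniform_measure_def
    by (intro density_cong) (auto simp: indicator_def divide_ennreal simp flip: ennreal_1)
  then have "(\<integral>t. h t \<partial>uniform_measure lborel {0..<2 * pi})
      = (\<integral>t. indicator {0..<2 * pi} t / (2 * pi) * h t \<partial>lborel)"
    by (simp, subst integral_density) auto
  also have "\<dots> = (\<integral>t. indicator {0..2 * pi} t *\<^sub>R h t / (2 * pi) \<partial>lborel)"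
  proof (intro integral_cong_AE)
    have "AE t in lborel. t \<noteq> 2 * pi" by (rule AE_lborel_singleton)
    then show "AE t in lborel. indicator {0..<2 * pi} t / (2 * pi) * h t
                  = indicator {0..2 * pi} t *\<^sub>R h t / (2 * pi)"
      by eventually_elim (auto simp: indicator_def)
  qed auto
  also have "\<dots> = (LINT t:{0..2 * pi}|lborel. h t) / (2 * pi)"
    by (simp add: set_lebesgue_integral_def)
  also have "(LINT t:{0..2 * pi}|lborel. h t) = integral {0..2 * pi} h"
    using assms by (intro set_borel_integral_eq_integral borel_integrable_atLeastAtMost')
      (auto intro: continuous_on_subset)
  finally show ?thesis .
qed

context
  fixes l :: real
  assumes l: "1 < l" "l < 2"
begin

lemma half_exponent: "1/2 < l/2" "l/2 < 1"
  using l by auto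

lemma chord_powr:
  assumes "cmod z = 1" "cmod u = 1"
  shows "cmod (z - u) powr l = block_potential (l/2) 0 ((cmod (z - u))\<^sup>2)"
  using chord_antipode(3)[OF assms] l
  by (simp add: block_potential_0[OF half_exponent] powr_powr flip: powr_numeral)

lemma block_potential_merge:
  assumes "cmod z = 1" "cmod u = 1"
  shows "block_potential (l/2) i ((cmod (z - u))\<^sup>2) + block_potential (l/2) i ((cmod (z + u))\<^sup>2)
       = block_potential (l/2) (Suc i) ((cmod (z\<^sup>2 - u\<^sup>2))\<^sup>2)"
  using block_potential_Suc[OF half_exponent _ chord_antipode(3)[OF assms]]
  by (simp add: chord_antipode(1,2)[OF assms])

lemma sum_chords_equally_spaced:
  assumes y: "cmod y = 1"
  shows "(\<Sum>j<2 ^ i. cmod (cis (s + 2 * pi * real j / 2 ^ i) - y) powr l)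
       = block_potential (l/2) i ((cmod (cis (2 ^ i * s) - y ^ (2 ^ i)))\<^sup>2)"
proof (induction i arbitrary: s)
  case 0
  show ?case using y by (simp add: chord_powr)
next
  case (Suc i)
  have "(\<Sum>j<2 ^ Suc i. cmod (cis (s + 2 * pi * real j / 2 ^ Suc i) - y) powr l)
      = (\<Sum>j<2 ^ i. cmod (cis (s + 2 * pi * real j / 2 ^ i) - y) powr l)
      + (\<Sum>j<2 ^ i. cmod (cis ((s + pi / 2 ^ i) + 2 * pi * real j / 2 ^ i) - y) powr l)"
    by (simp add: sum_even_odd_split field_simps)
  also have "\<dots> = block_potential (l/2) i ((cmod (cis (2 ^ i * s) - y ^ (2 ^ i)))\<^sup>2)
      + block_potential (l/2) i ((cmod (cis (2 ^ i * s) + y ^ (2 ^ i)))\<^sup>2)"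
  proof -
    have "2 ^ i * (s + pi / 2 ^ i) = 2 ^ i * s + pi" by (simp add: field_simps)
    then have "cis (2 ^ i * (s + pi / 2 ^ i)) - y ^ (2 ^ i) = - (cis (2 ^ i * s) + y ^ (2 ^ i))"
      by (simp flip: cis_mult)
    then show ?thesis by (simp only: Suc norm_minus_cancel)
  qed
  also have "\<dots> = block_potential (l/2) (Suc i) ((cmod ((cis (2 ^ i * s))\<^sup>2 - (y ^ (2 ^ i))\<^sup>2))\<^sup>2)"
    using y by (intro block_potential_merge) (auto simp: norm_power)
  also have "(cis (2 ^ i * s))\<^sup>2 = cis (2 ^ Suc i * s)"
    by (simp add: power2_eq_square cis_mult mult_ac)
  also have "(y ^ (2 ^ i))\<^sup>2 = y ^ (2 ^ Suc i)"
    by (simp add: mult.commute flip: power_mult)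
  finally show ?case .
qed

lemma continuous_chord_powr: "continuous_on UNIV (\<lambda>s. cmod (cis s - y) powr l)"
  using l by (intro continuous_on_powr' continuous_intros) auto

text \<open>
  Cutting the circle into \<open>2 ^ i\<close> arcs and superposing them turns the integrand into the potential of
  \<open>2 ^ i\<close> equally spaced points, which is uniformly close to its mean. Letting \<open>i\<close> grow leaves the
  mean potential.
\<close>
lemma integral_chord_powr:
  assumes y: "cmod y = 1"
  shows "integral {0..2 * pi} (\<lambda>s. cmod (cis s - y) powr l) = 2 * pi * mean_potential (l/2)"
proof -
  define J where "J = mean_potential (l/2)"
  define g where "g = (\<lambda>s. cmod (cis s - y) powr l)"
  have cont: "continuous_on UNIV g"
    unfolding g_def by (rule continuous_chord_powr)
  obtain C where C: "0 \<le> C"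
    "\<forall>i. \<forall>X\<in>{0..4}. \<bar>block_potential (l/2) i X - 2 ^ i * J\<bar> \<le> C / 2 ^ i"
    unfolding J_def using block_potential_near_mean[OF half_exponent] by blast
  have bound: "\<bar>integral {0..2 * pi} g - 2 * pi * J\<bar> \<le> 2 * pi * C * (1/4) ^ i" for i
  proof -
    define h where "h = 2 * pi / 2 ^ i"
    define S where "S = (\<lambda>s. \<Sum>j<2 ^ i. g (s + real j * h))"
    have "continuous_on {0..h} S"
      unfolding S_def by (intro continuous_intros continuous_on_compose2[OF cont]) auto
    then have S_int: "S integrable_on {0..h}" by (rule integrable_continuous_interval)
    have "integral {0..2 * pi} g = integral {0..h} S"
      using integral_split_equal_pieces[OF cont, of h "2 ^ i"] by (simp add: h_def S_def)
    moreover have "2 * pi * J = integral {0..h} (\<lambda>s. 2 ^ i * J)"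
      by (simp add: h_def)
    moreover have "integral {0..h} (\<lambda>s. S s - 2 ^ i * J) = integral {0..h} S - integral {0..h} (\<lambda>s. 2 ^ i * J)"
      by (intro Henstock_Kurzweil_Integration.integral_diff S_int integrable_const_ivl)
    ultimately have "integral {0..2 * pi} g - 2 * pi * J = integral {0..h} (\<lambda>s. S s - 2 ^ i * J)"
      by simp
    also have "norm \<dots> \<le> C / 2 ^ i * Henstock_Kurzweil_Integration.content (cbox 0 h)"
      unfolding cbox_interval[symmetric]
    proof (rule integrable_bound)
      show "0 \<le> C / 2 ^ i" using C by simp
      show "(\<lambda>s. S s - 2 ^ i * J) integrable_on cbox 0 h"
        using S_int by (auto intro: integrable_diff)
      fix s
      have "S s = block_potential (l/2) i ((cmod (cis (2 ^ i * s) - y ^ (2 ^ i)))\<^sup>2)"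
        unfolding S_def g_def h_def by (subst sum_chords_equally_spaced[OF y, symmetric]) (simp add: mult_ac)
      moreover have "(cmod (cis (2 ^ i * s) - y ^ (2 ^ i)))\<^sup>2 \<le> 4"
        using y by (intro chord_antipode(3)) (auto simp: norm_power)
      ultimately show "norm (S s - 2 ^ i * J) \<le> C / 2 ^ i" using C(2) by simp
    qed
    also have "\<dots> = 2 * pi * C * (1/4) ^ i"
    proof -
      have "(4::real) ^ i = 2 ^ i * 2 ^ i" by (simp flip: power_mult_distrib)
      then show ?thesis by (simp add: h_def power_one_over field_simps)
    qed
    finally show ?thesis by simp
  qed
  have "(\<lambda>i. 2 * pi * C * (1/4) ^ i) \<longlonglongrightarrow> 2 * pi * C * 0"
    by (intro tendsto_intros LIMSEQ_power_zero) auto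
  then have "\<bar>integral {0..2 * pi} g - 2 * pi * J\<bar> \<le> 0"
    using bound by (intro tendsto_lowerbound[where F = sequentially]) (auto intro: always_eventually)
  then show ?thesis by (simp add: g_def J_def)
qed

theorem cont_energy_eq_mean_potential: "cont_energy l sigma1 = mean_potential (l/2)"
proof -
  have cis_meas: "cis \<in> measurable (uniform_measure lborel {0..<2 * pi}) borel"
    by (simp add: borel_measurable_continuous_onI continuous_intros cong: measurable_cong_sets)
  have inner: "(\<integral>x. cmod (x - y) powr l \<partial>sigma1) = mean_potential (l/2)" if "cmod y = 1" for y
  proof -
    have "(\<integral>x. cmod (x - y) powr l \<partial>sigma1)
        = (\<integral>s. cmod (cis s - y) powr l \<partial>uniform_measure lborel {0..<2 * pi})"
      unfolding sigma1_def by (intro integral_distr cis_meas) measurable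
    also have "\<dots> = mean_potential (l/2)"
      using that by (simp add: integral_uniform_arc[OF continuous_chord_powr] integral_chord_powr)
    finally show ?thesis .
  qed
  have sets [measurable_cong]: "sets sigma1 = sets borel" by (simp add: sigma1_def)
  have total: "emeasure sigma1 (space sigma1) = 1"
    unfolding sigma1_def using cis_meas by (simp add: emeasure_distr emeasure_uniform_measure_1)
  interpret finite_measure sigma1
    using total by (intro finite_measureI) simp
  have "cont_energy l sigma1 = (\<integral>y. mean_potential (l/2) \<partial>sigma1)"
    unfolding cont_energy_def
  proof (intro integral_cong_AE)
    have "AE y in sigma1. cmod y = 1"
      unfolding sigma1_def by (subst AE_distr_iff[OF cis_meas]) auto
    then show "AE y in sigma1. (\<integral>x. cmod (x - y) powr l \<partial>sigma1) = mean_potential (l/2)"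
      by eventually_elim (rule inner)
  qed measurable
  then show ?thesis using total by (simp add: measure_def)
qed

end

section \<open>Binary structure of greedy sequences\<close>

text \<open>
  If digit \<open>i\<close> of \<open>k\<close> is \<open>1\<close>, the aligned block of \<open>2 ^ i\<close> indices containing \<open>k\<close> is the right half of an aligned
  block of twice the size. The condition says that the \<open>2 ^ i\<close>-th powers of the two halves are opposite.
  It makes every complete aligned block of \<open>2 ^ i\<close> indices a coset of the \<open>2 ^ i\<close>-th roots of unity.
\<close>
definition dyadic_antipodal :: "(nat \<Rightarrow> complex) \<Rightarrow> nat \<Rightarrow> bool" where
  "dyadic_antipodal a N \<longleftrightarrow>
     (\<forall>k<N. \<forall>i. odd (k div 2 ^ i) \<longrightarrow>
        a k ^ (2 ^ i) = - (a (k div 2 ^ Suc i * 2 ^ Suc i) ^ (2 ^ i)))"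

lemma div_power_Suc: "(k::nat) div 2 ^ Suc i = k div 2 ^ i div 2"
  by (simp add: power_Suc2 div_mult2_eq del: power_Suc)

lemma power_two_power_Suc: "x ^ (2 ^ Suc i) = (x ^ (2 ^ i))\<^sup>2" for x :: "'a::monoid_mult"
  by (simp only: power_Suc2 power_mult)

text \<open>
  Reading the binary digits of \<open>N\<close> from the top splits the indices below \<open>N\<close> into aligned dyadic blocks, one
  for each digit \<open>1\<close>; the digits from \<open>m\<close> on are collected in the first sum.
\<close>
lemma sum_binary_blocks:
  fixes g :: "nat \<Rightarrow> 'b::comm_monoid_add"
  shows "(\<Sum>k<N. g k) = (\<Sum>k<N div 2 ^ m * 2 ^ m. g k)
    + (\<Sum>i<m. if odd (N div 2 ^ i)
              then \<Sum>k\<in>{2 * (N div 2 ^ Suc i) * 2 ^ i..<(2 * (N div 2 ^ Suc i) + 1) * 2 ^ i}. g k else 0)"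
proof (induction m)
  case (Suc m)
  define q where "q = N div 2 ^ Suc m"
  have split: "(\<Sum>k<N div 2 ^ m * 2 ^ m. g k) = (\<Sum>k<q * 2 ^ Suc m. g k)
     + (if odd (N div 2 ^ m) then \<Sum>k\<in>{2 * q * 2 ^ m..<(2 * q + 1) * 2 ^ m}. g k else 0)"
  proof (cases "odd (N div 2 ^ m)")
    case True
    then have N: "N div 2 ^ m = 2 * q + 1" unfolding q_def div_power_Suc by simp
    have "(\<Sum>k\<in>{0..<2 * q * 2 ^ m}. g k) + (\<Sum>k\<in>{2 * q * 2 ^ m..<(2 * q + 1) * 2 ^ m}. g k)
        = (\<Sum>k\<in>{0..<(2 * q + 1) * 2 ^ m}. g k)"
      by (intro sum.atLeastLessThan_concat) auto
    moreover have "2 * q * 2 ^ m = q * 2 ^ Suc m" by simp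
    ultimately show ?thesis
      unfolding N by (simp add: atLeast0LessThan mult_ac)
  next
    case False
    then have "N div 2 ^ m = 2 * q" unfolding q_def div_power_Suc by simp
    then show ?thesis by (simp add: mult_ac)
  qed
  show ?case
    by (subst Suc, subst split) (simp add: q_def add_ac del: power_Suc)
qed simp

lemma odd_part_exists: "0 < n \<Longrightarrow> \<exists>p q::nat. n = 2 ^ p * q \<and> odd q"
proof (induction n rule: less_induct)
  case (less n)
  show ?case
  proof (cases "even n")
    case True
    then obtain n' where n': "n = 2 * n'" by (elim evenE)
    with less have "\<exists>p q. n' = 2 ^ p * q \<and> odd q" by simp
    then obtain p q where "n' = 2 ^ p * q" "odd q" by blast
    then have "n = 2 ^ Suc p * q \<and> odd q" using n' by simp
    then show ?thesis by blast
  next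
    case False
    then have "n = 2 ^ 0 * n \<and> odd n" by simp
    then show ?thesis by blast
  qed
qed

lemma unit_circle_root:
  assumes "cmod b = 1"
  shows "\<exists>x. cmod x = 1 \<and> x ^ (2 ^ p) = b"
proof -
  define t where "t = Arg b"
  have t: "b = cis t"
    using assms cis_Arg[of b] by (cases "b = 0") (auto simp: t_def sgn_div_norm)
  have "cis (t / 2 ^ p) ^ (2 ^ p) = b" by (simp add: Complex.DeMoivre t)
  then show ?thesis by (intro exI[of _ "cis (t / 2 ^ p)"]) simp
qed

text \<open>
  A point antipodal to the smallest block, of size \<open>2 ^ p\<close>, works for all larger blocks: its powers of
  order \<open>2 ^ i\<close>, \<open>i > p\<close>, agree with those of the smallest block, because the sign disappears, and that
  block was itself placed antipodally to the larger ones.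
\<close>
lemma common_antipode_exists:
  assumes anti: "dyadic_antipodal a N" and N: "0 < N" and unit: "\<And>k. cmod (a k) = 1"
  shows "\<exists>x. cmod x = 1 \<and> (\<forall>i. odd (N div 2 ^ i) \<longrightarrow>
           x ^ (2 ^ i) = - (a (N div 2 ^ Suc i * 2 ^ Suc i) ^ (2 ^ i)))"
proof -
  obtain p q where pq: "N = 2 ^ p * q" "odd q" using odd_part_exists[OF N] by blast
  define M where "M = 2 ^ p * (q - 1)"
  have q: "0 < q" using pq by (auto intro: Nat.gr0I)
  have M: "M < N" using q pq by (simp add: M_def)
  have "cmod (- (a M ^ (2 ^ p))) = 1" by (simp add: norm_power unit)
  then obtain x where x: "cmod x = 1" "x ^ (2 ^ p) = - (a M ^ (2 ^ p))"
    using unit_circle_root by blast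
  have half: "(q - 1) div 2 = q div 2" using pq(2) by (elim oddE) simp
  have "x ^ (2 ^ i) = - (a (N div 2 ^ Suc i * 2 ^ Suc i) ^ (2 ^ i))" if i: "odd (N div 2 ^ i)" for i
  proof -
    consider "i < p" | "i = p" | "p < i" by linarith
    then show ?thesis
    proof cases
      case 1
      then have "N = 2 ^ i * (2 * (2 ^ (p - Suc i) * q))"
        unfolding pq by (simp flip: power_Suc power_add add: mult.assoc[symmetric])
      then have "N div 2 ^ i = 2 * (2 ^ (p - Suc i) * q)" by simp
      with i show ?thesis by simp
    next
      case 2
      have "N div 2 ^ Suc i * 2 ^ Suc i = M"
        unfolding div_power_Suc using pq 2 by (simp add: M_def odd_two_times_div_two_nat mult_ac)
      then show ?thesis using x 2 by simp
    next
      case 3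
      \<comment> \<open>The exponent \<open>2 ^ i\<close> contains one squaring beyond \<open>2 ^ p\<close>, which removes the sign in \<open>x(2)\<close>.\<close>
      define j where "j = i - Suc p"
      then have j: "i = p + Suc j" using 3 by simp
      have same: "M div 2 ^ r = N div 2 ^ r" if "p < r" for r
      proof -
        define j where "j = r - Suc p"
        then have "r = p + Suc j" using that by simp
        then have pow: "2 ^ r = 2 ^ p * (2 * 2 ^ j :: nat)" by (simp add: power_add)
        have "M div 2 ^ p = q - 1" "N div 2 ^ p = q" by (simp_all add: M_def pq(1))
        then show ?thesis by (simp only: pow div_mult2_eq half)
      qed
      have pow: "2 ^ i = 2 ^ p * (2 * 2 ^ j :: nat)" using j by (simp add: power_add)
      have "x ^ (2 ^ i) = ((- (a M ^ (2 ^ p)))\<^sup>2) ^ (2 ^ j)"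
        by (simp only: pow power_mult x(2))
      also have "\<dots> = a M ^ (2 ^ i)"
        by (simp add: pow power_mult)
      also have "\<dots> = - (a (M div 2 ^ Suc i * 2 ^ Suc i) ^ (2 ^ i))"
        using anti M i same[OF 3] by (auto simp: dyadic_antipodal_def)
      also have "M div 2 ^ Suc i = N div 2 ^ Suc i"
        using 3 by (intro same) simp
      finally show ?thesis .
    qed
  qed
  with x(1) show ?thesis by blast
qed

lemma odd_div_power_imp_less: "odd (N div 2 ^ i) \<Longrightarrow> N < 2 ^ m \<Longrightarrow> i < m" for N :: nat
proof (rule ccontr)
  assume o: "odd (N div 2 ^ i)" and N: "N < 2 ^ m" and "\<not> i < m"
  then have "(2::nat) ^ m \<le> 2 ^ i" by (intro power_increasing) auto
  then have "N < 2 ^ i" using N by linarith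
  with o show False by simp
qed

context
  fixes l :: real and a :: "nat \<Rightarrow> complex"
  assumes l: "1 < l" "l < 2" and unit: "\<And>k. cmod (a k) = 1"
begin

lemma sum_chords_dyadic_block:
  assumes "dyadic_antipodal a N" "(j + 1) * 2 ^ i \<le> N" "cmod x = 1"
  shows "(\<Sum>k\<in>{j * 2 ^ i..<(j + 1) * 2 ^ i}. cmod (x - a k) powr l)
       = block_potential (l/2) i ((cmod (x ^ (2 ^ i) - a (j * 2 ^ i) ^ (2 ^ i)))\<^sup>2)"
  using assms(2)
proof (induction i arbitrary: j)
  case 0
  have "{j..<Suc j} = {j}" by auto
  then show ?case using chord_powr[OF l assms(3) unit] by simp
next
  case (Suc i)
  define z u where "z = x ^ (2 ^ i)" and "u = a (2 * j * 2 ^ i) ^ (2 ^ i)"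
  have zu: "cmod z = 1" "cmod u = 1" using assms(3) unit by (auto simp: z_def u_def norm_power)
  have bnd: "(2 * j + 1 + 1) * 2 ^ i \<le> N" "(2 * j + 1) * 2 ^ i < N"
  proof -
    show 1: "(2 * j + 1 + 1) * 2 ^ i \<le> N" using Suc.prems by (simp add: algebra_simps)
    have "(2 * j + 1) * 2 ^ i < (2 * j + 1 + 1) * 2 ^ i" by simp
    with 1 show "(2 * j + 1) * 2 ^ i < N" by linarith
  qed
  have e: "a ((2 * j + 1) * 2 ^ i) ^ (2 ^ i) = - u"
  proof -
    have "(2 * j + 1) * 2 ^ i div 2 ^ i = 2 * j + 1" by (rule nonzero_mult_div_cancel_right) simp
    moreover from this have "(2 * j + 1) * 2 ^ i div 2 ^ Suc i * 2 ^ Suc i = 2 * j * 2 ^ i"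
      unfolding div_power_Suc by simp
    ultimately show ?thesis
      using assms(1) bnd(2) unfolding dyadic_antipodal_def u_def
      by (metis even_add even_mult_iff even_numeral odd_one)
  qed
  have "(\<Sum>k\<in>{j * 2 ^ Suc i..<(j + 1) * 2 ^ Suc i}. cmod (x - a k) powr l)
      = (\<Sum>k\<in>{2 * j * 2 ^ i..<(2 * j + 1) * 2 ^ i}. cmod (x - a k) powr l)
      + (\<Sum>k\<in>{(2 * j + 1) * 2 ^ i..<(2 * j + 1 + 1) * 2 ^ i}. cmod (x - a k) powr l)"
    by (subst sum.atLeastLessThan_concat) (auto simp: algebra_simps)
  also have "\<dots> = block_potential (l/2) i ((cmod (z - u))\<^sup>2) + block_potential (l/2) i ((cmod (z + u))\<^sup>2)"
    using bnd by (simp only: Suc.IH[of "2 * j"] Suc.IH[of "2 * j + 1"] e z_def[symmetric]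
       u_def[symmetric] diff_minus_eq_add less_imp_le)
  also have "\<dots> = block_potential (l/2) (Suc i) ((cmod (z\<^sup>2 - u\<^sup>2))\<^sup>2)"
    by (rule block_potential_merge[OF l zu])
  also have "z\<^sup>2 = x ^ (2 ^ Suc i)" by (simp only: z_def power_two_power_Suc)
  also have "u\<^sup>2 = a (j * 2 ^ Suc i) ^ (2 ^ Suc i)" by (simp add: u_def power_two_power_Suc mult_ac del: power_Suc) (simp add: mult_ac)?
  finally show ?case .
qed

lemma potential_binary_expansion:
  assumes "dyadic_antipodal a N" "N < 2 ^ m" "cmod x = 1"
  shows "(\<Sum>k<N. cmod (x - a k) powr l)
       = (\<Sum>i<m. if odd (N div 2 ^ i)
            then block_potential (l/2) i
                   ((cmod (x ^ (2 ^ i) - a (N div 2 ^ Suc i * 2 ^ Suc i) ^ (2 ^ i)))\<^sup>2) else 0)"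
proof -
  have "(\<Sum>k\<in>{2 * (N div 2 ^ Suc i) * 2 ^ i..<(2 * (N div 2 ^ Suc i) + 1) * 2 ^ i}. cmod (x - a k) powr l)
      = block_potential (l/2) i
          ((cmod (x ^ (2 ^ i) - a (N div 2 ^ Suc i * 2 ^ Suc i) ^ (2 ^ i)))\<^sup>2)"
    if "odd (N div 2 ^ i)" for i
  proof -
    have "2 * (N div 2 ^ Suc i) + 1 = N div 2 ^ i"
      unfolding div_power_Suc using that by simp
    then have "(2 * (N div 2 ^ Suc i) + 1) * 2 ^ i \<le> N" by simp
    moreover have "2 * (N div 2 ^ Suc i) * 2 ^ i = N div 2 ^ Suc i * 2 ^ Suc i" by simp
    ultimately show ?thesis
      using sum_chords_dyadic_block[OF assms(1) _ assms(3), of "2 * (N div 2 ^ Suc i)" i]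
      by (simp only:)
  qed
  then show ?thesis
    using assms(2) by (subst sum_binary_blocks[where m = m]) (simp cong: if_cong)
qed

text \<open>
  The potential is a sum of block potentials, each strictly maximal only at antipodal position. Since
  some point attains all maxima at once, the greedy point must attain each of them.
\<close>
theorem greedy_dyadic_antipodal:
  assumes greedy: "greedy_energy_seq l a"
  shows "dyadic_antipodal a N"
proof (induction N)
  case 0
  then show ?case by (simp add: dyadic_antipodal_def)
next
  case (Suc N)
  have "a N ^ (2 ^ i) = - (a (N div 2 ^ Suc i * 2 ^ Suc i) ^ (2 ^ i))" if i: "odd (N div 2 ^ i)" for i
  proof -
    have N: "0 < N" using i by (intro Nat.gr0I) auto
    define t where "t = (\<lambda>x i. if odd (N div 2 ^ i)
            then block_potential (l/2) i
                   ((cmod (x ^ (2 ^ i) - a (N div 2 ^ Suc i * 2 ^ Suc i) ^ (2 ^ i)))\<^sup>2) else 0)"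
    have pot: "(\<Sum>k<N. cmod (x - a k) powr l) = (\<Sum>i<N. t x i)" if "cmod x = 1" for x
      unfolding t_def by (rule potential_binary_expansion[OF Suc less_exp that])
    obtain x where x: "cmod x = 1" "\<And>i. odd (N div 2 ^ i) \<Longrightarrow>
           x ^ (2 ^ i) = - (a (N div 2 ^ Suc i * 2 ^ Suc i) ^ (2 ^ i))"
      using common_antipode_exists[OF Suc N unit] by blast
    have unit_pow: "cmod (a k ^ n) = 1" for k n by (simp add: norm_power unit)
    have x4: "(cmod (x ^ (2 ^ i) - a (N div 2 ^ Suc i * 2 ^ Suc i) ^ (2 ^ i)))\<^sup>2 = 4"
      if "odd (N div 2 ^ i)" for i
      using x(1) unit_pow x(2)[OF that] by (subst chord_max_iff) (auto simp: norm_power)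
    have le4: "(cmod (a N ^ (2 ^ i) - a (N div 2 ^ Suc i * 2 ^ Suc i) ^ (2 ^ i)))\<^sup>2 \<le> 4" for i
      by (intro chord_antipode(3) unit_pow)
    have le: "t (a N) j \<le> t x j" for j
    proof (cases "odd (N div 2 ^ j)")
      case True
      show ?thesis
        using block_potential_less_top[OF half_exponent[OF l] zero_le_power2, of _ j] le4[of j]
        unfolding t_def x4[OF True] by (auto simp: le_less simp del: power_Suc)
    qed (simp add: t_def)
    have "(\<Sum>i<N. t x i) \<le> (\<Sum>i<N. t (a N) i)"
      using greedy N x(1) unit unfolding greedy_energy_seq_def S1_def
      by (simp add: pot[symmetric])
    moreover have "i < N" using odd_div_power_imp_less[OF i less_exp] .
    ultimately have "t (a N) i = t x i"
      using sum_strict_mono_ex1[of "{..<N}" "t (a N)" "t x"] le by (force simp: le_less)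
    then have "(cmod (a N ^ (2 ^ i) - a (N div 2 ^ Suc i * 2 ^ Suc i) ^ (2 ^ i)))\<^sup>2 = 4"
      using block_potential_less_top[OF half_exponent[OF l] zero_le_power2, of _ i] le4[of i] i
      unfolding t_def x4[OF i] by (force simp: le_less simp del: power_Suc)
    then show ?thesis by (subst (asm) chord_max_iff[OF unit_pow unit_pow])
  qed
  then show ?case using Suc by (auto simp: dyadic_antipodal_def less_Suc_eq simp del: power_Suc)
qed

lemma greedy_potential:
  assumes greedy: "greedy_energy_seq l a" and "N < 2 ^ m"
  shows "(\<Sum>k<N. cmod (a N - a k) powr l)
       = (\<Sum>i<m. if odd (N div 2 ^ i) then block_potential (l/2) i 4 else 0)"
proof (subst potential_binary_expansion[OF greedy_dyadic_antipodal[OF greedy] assms(2) unit],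
    intro sum.cong refl if_cong)
  fix i assume "odd (N div 2 ^ i)"
  then have "a N ^ (2 ^ i) = - (a (N div 2 ^ Suc i * 2 ^ Suc i) ^ (2 ^ i))"
    using greedy_dyadic_antipodal[OF greedy, of "Suc N"] by (simp add: dyadic_antipodal_def del: power_Suc)
  then have "(cmod (a N ^ (2 ^ i) - a (N div 2 ^ Suc i * 2 ^ Suc i) ^ (2 ^ i)))\<^sup>2 = 4"
    by (subst chord_max_iff) (auto simp: norm_power unit)
  then show "block_potential (l/2) i
       ((cmod (a N ^ (2 ^ i) - a (N div 2 ^ Suc i * 2 ^ Suc i) ^ (2 ^ i)))\<^sup>2) = block_potential (l/2) i 4"
    by simp
qed

end

lemma energy_eq_sum_potentials:
  "energy l N a = 2 * (\<Sum>n<N. \<Sum>k<n. cmod (a n - a k) powr l)"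
proof -
  have "energy l N a = (\<Sum>i<N. \<Sum>j<N. cmod (a i - a j) powr l)"
    unfolding energy_def by (intro sum.cong refl sum.mono_neutral_left) auto
  also have "\<dots> = 2 * (\<Sum>n<N. \<Sum>k<n. cmod (a n - a k) powr l)"
    by (induction N) (auto simp: sum.distrib norm_minus_commute)
  finally show ?thesis .
qed

section \<open>The energy as a sum of distances to dyadic grids\<close>

text \<open>
  The distance from \<open>N\<close> to the nearest multiple of \<open>2 ^ Suc i\<close>.
\<close>
definition dyadic_distance :: "nat \<Rightarrow> nat \<Rightarrow> nat" where
  "dyadic_distance i N = min (N mod 2 ^ Suc i) (2 ^ Suc i - N mod 2 ^ Suc i)"

lemma dyadic_distance_le: "dyadic_distance i N \<le> 2 ^ i"
  by (auto simp: dyadic_distance_def min_def)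

lemma dyadic_distance_Suc:
  "real (dyadic_distance i (Suc N)) = real (dyadic_distance i N) + (-1) ^ (N div 2 ^ i)"
proof -
  define Q r q where "Q = (2::nat) ^ i" and "r = N mod 2 ^ Suc i" and "q = N div 2 ^ Suc i"
  have Q: "0 < Q" "2 ^ Suc i = 2 * Q" by (auto simp: Q_def)
  have r: "r < 2 * Q" using Q by (auto simp: r_def)
  have N: "N = 2 * Q * q + r" unfolding r_def q_def Q(2)[symmetric] by simp
  have s: "Suc N mod (2 * Q) = (if Suc r = 2 * Q then 0 else Suc r)"
    unfolding r_def Q(2) by (simp add: mod_Suc)
  have "N = Q * (2 * q) + r" by (simp add: N)
  then have d: "N div Q = 2 * q + r div Q" using Q by (simp add: div_mult_self4)
  show ?thesis
  proof (cases "r < Q")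
    case True
    then have "N div 2 ^ i = 2 * q" using d by (simp add: Q_def)
    moreover have "min r (2 * Q - r) = r" "min (Suc r) (2 * Q - Suc r) = Suc r"
      using True by linarith+
    ultimately show ?thesis
      unfolding dyadic_distance_def Q(2) s r_def[symmetric, unfolded Q(2)] using True by simp
  next
    case False
    then have "r div Q = 1" using r Q by (intro div_nat_eqI) auto
    then have "N div 2 ^ i = Suc (2 * q)" using d by (simp add: Q_def)
    moreover have "min r (2 * Q - r) = 2 * Q - r" using False by linarith
    moreover have "min (if Suc r = 2 * Q then 0 else Suc r) (2 * Q - (if Suc r = 2 * Q then 0 else Suc r))
        = 2 * Q - Suc r"
      using False by auto
    moreover have "real (2 * Q - Suc r) = real (2 * Q - r) - 1"
      using r by (simp add: of_nat_diff)
    ultimately show ?thesis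
      unfolding dyadic_distance_def Q(2) s r_def[symmetric, unfolded Q(2)] by simp
  qed
qed

text \<open>
  Digit \<open>i\<close> alternates between runs of \<open>2 ^ i\<close> zeros and \<open>2 ^ i\<close> ones, so the signed count is a zigzag
  function of \<open>N\<close>.
\<close>
lemma dyadic_distance_eq_sum:
  "real (dyadic_distance i N) = (\<Sum>n<N. (-1) ^ (n div 2 ^ i))"
  by (induction N) (simp_all add: dyadic_distance_Suc, simp add: dyadic_distance_def)

lemma dyadic_distance_self: "N \<le> 2 ^ i \<Longrightarrow> dyadic_distance i N = N"
proof -
  assume le: "N \<le> 2 ^ i"
  have "(0::nat) < 2 ^ i" by simp
  then have "N < 2 ^ Suc i" "N \<le> 2 ^ Suc i - N" using le unfolding power_Suc by linarith+
  then show ?thesis by (simp add: dyadic_distance_def min_def del: power_Suc)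
qed

lemma dyadic_distance_add_power: "i < n \<Longrightarrow> dyadic_distance i (N + 2 ^ n) = dyadic_distance i N"
proof -
  assume "i < n"
  then have "2 ^ Suc i dvd (2::nat) ^ n" by (intro le_imp_power_dvd) simp
  then show ?thesis by (auto simp: dyadic_distance_def elim!: dvdE simp del: power_Suc)
qed

lemma dyadic_distance_power: "i < n \<Longrightarrow> dyadic_distance i (2 ^ n) = 0"
  using dyadic_distance_add_power[of i n 0] by (simp add: dyadic_distance_self)

lemma dyadic_distance_reflect:
  assumes "i < n" "N \<le> 2 ^ n"
  shows "dyadic_distance i (2 ^ n - N) = dyadic_distance i N"
proof -
  define Q r where "Q = (2::nat) ^ Suc i" and "r = N mod Q"
  have "Q dvd 2 ^ n" unfolding Q_def using assms by (intro le_imp_power_dvd) simp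
  then obtain c where c: "2 ^ n = Q * c" by (elim dvdE)
  have Q: "0 < Q" by (simp add: Q_def)
  have r: "r < Q" using Q by (simp add: r_def)
  obtain q where N: "N = Q * q + r" unfolding r_def by (metis mult_div_mod_eq)
  have "(2 ^ n - N) mod Q = (if r = 0 then 0 else Q - r)"
  proof (cases "r = 0")
    case True
    then show ?thesis by (simp add: c N flip: right_diff_distrib')
  next
    case False
    have "Q * q + r \<le> Q * c" using assms(2) unfolding c N .
    then have "Q * q < Q * c" using False by linarith
    then have "q < c" by simp
    then obtain d where "c = Suc (q + d)" using less_imp_Suc_add by auto
    then have "2 ^ n - N = Q * d + (Q - r)" using r by (simp add: c N algebra_simps)
    moreover have "Q - r < Q" using False Q by simp
    ultimately show ?thesis using False by (simp only: mod_mult_self4 mod_less if_False)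
  qed
  then show ?thesis
    unfolding dyadic_distance_def Q_def[symmetric] r_def[symmetric] using r by (auto simp: min_def)
qed

text \<open>
  The Jacobsthal numbers \<open>0, 1, 1, 3, 5, 11, 21, \<dots>\<close>. This first-order recursion is chosen because the
  reflection \<open>N \<mapsto> 2 ^ n - N\<close> preserves the distance to every dyadic grid of mesh at most \<open>2 ^ n\<close>.
\<close>
fun jacobsthal :: "nat \<Rightarrow> nat" where
  "jacobsthal 0 = 0"
| "jacobsthal (Suc n) = 2 ^ n - jacobsthal n"

lemma jacobsthal_le: "jacobsthal n \<le> 2 ^ n"
  by (induction n) (auto intro: le_trans[OF diff_le_self])

lemma jacobsthal_eq: "3 * real (jacobsthal n) = 2 ^ n - (-1) ^ n"
  by (induction n) (simp_all add: of_nat_diff jacobsthal_le)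

lemma dyadic_distance_jacobsthal:
  "i < n \<Longrightarrow> real (dyadic_distance i (jacobsthal n)) = (2 ^ Suc i + (-1) ^ i) / 3"
proof (induction n)
  case (Suc n)
  show ?case
  proof (cases "i = n")
    case True
    have "dyadic_distance i (jacobsthal (Suc n)) = jacobsthal (Suc n)"
      using True by (intro dyadic_distance_self) simp
    then show ?thesis using jacobsthal_eq[of "Suc n"] True by simp
  next
    case False
    then show ?thesis using Suc by (simp add: dyadic_distance_reflect jacobsthal_le)
  qed
qed simp

lemma strict_mono_jacobsthal: "strict_mono (\<lambda>n. jacobsthal (n + 2))"
proof (rule strict_monoI_Suc)
  fix n
  have "real (jacobsthal (n + 2)) < real (jacobsthal (Suc n + 2))"
  proof -
    define p s :: real where "p = 2 ^ n" and "s = (-1) ^ n"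
    have "3 * real (jacobsthal (n + 2)) = 4 * p - s" "3 * real (jacobsthal (Suc n + 2)) = 8 * p + s"
      unfolding jacobsthal_eq by (simp_all add: p_def s_def)
    moreover have "1 \<le> p" by (simp add: p_def)
    moreover have "-1 \<le> s" by (cases "even n") (simp_all add: s_def)
    ultimately show ?thesis by linarith
  qed
  then show "jacobsthal (n + 2) < jacobsthal (Suc n + 2)" by simp
qed

lemma nat_eq_sum_binary_digits:
  "N < 2 ^ m \<Longrightarrow> real N = (\<Sum>i<m. if odd (N div 2 ^ i) then 2 ^ i else 0)"
  using sum_binary_blocks[of "\<lambda>_. 1::real" N m] by (simp add: algebra_simps cong: if_cong)

text \<open>
  How far the potential of \<open>2 ^ i\<close> equally spaced points, evaluated at one of them, stays below its average
  over the circle. Multiplied by \<open>- (2 ^ i)\<close> it is the energy of these points minus \<open>(2 ^ i)\<^sup>2\<close> times the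
  continuous energy.
\<close>
definition roots_deficit :: "real \<Rightarrow> nat \<Rightarrow> real" where
  "roots_deficit m i = 2 ^ i * mean_potential m - block_potential m i 0"

definition excess_series :: "real \<Rightarrow> nat \<Rightarrow> real" where
  "excess_series m N = (\<Sum>i. real (dyadic_distance i N) * block_excess m i)"

context
  fixes m :: real
  assumes m: "1/2 < m" "m < 1"
begin

lemma roots_deficit_0: "roots_deficit m 0 = mean_potential m"
  by (simp add: roots_deficit_def block_potential_0[OF m])

text \<open>
  The roots of order \<open>2 ^ Suc i\<close> consist of those of order \<open>2 ^ i\<close> and of the midpoints between them.
\<close>
lemma roots_deficit_diff: "roots_deficit m i - roots_deficit m (Suc i) = block_excess m i"
  using block_potential_Suc[OF m, of 0 i] by (simp add: roots_deficit_def block_excess_def)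

lemma sum_block_excess: "(\<Sum>i<K. block_excess m i) = mean_potential m - roots_deficit m K"
  by (induction K) (simp_all add: roots_deficit_0 flip: roots_deficit_diff)

lemma roots_deficit_bound: "\<exists>C. \<forall>i. 2 ^ i * \<bar>roots_deficit m i\<bar> \<le> C"
proof -
  obtain C where "\<forall>i. \<forall>X\<in>{0..4}. \<bar>block_potential m i X - 2 ^ i * mean_potential m\<bar> \<le> C / 2 ^ i"
    using block_potential_near_mean[OF m] by blast
  then have "\<bar>block_potential m i 0 - 2 ^ i * mean_potential m\<bar> \<le> C / 2 ^ i" for i by auto
  then have "2 ^ i * \<bar>roots_deficit m i\<bar> \<le> C" for i
    unfolding roots_deficit_def by (subst abs_minus_commute) (simp add: field_simps)
  then show ?thesis by blast
qed

lemma roots_deficit_tendsto: "roots_deficit m \<longlonglongrightarrow> 0"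
proof -
  obtain C where "\<forall>i. 2 ^ i * \<bar>roots_deficit m i\<bar> \<le> C"
    using roots_deficit_bound by blast
  then have bound: "norm (roots_deficit m i) \<le> C * (1/2) ^ i" for i
    by (simp add: power_one_over field_simps)
  have "(\<lambda>i. C * (1/2) ^ i) \<longlonglongrightarrow> C * 0"
    by (intro tendsto_intros LIMSEQ_power_zero) auto
  then have "(\<lambda>i. C * (1/2) ^ i) \<longlonglongrightarrow> 0" by simp
  with always_eventually[OF allI[OF bound]] show ?thesis by (rule Lim_null_comparison)
qed

lemma roots_deficit_nonneg: "0 \<le> roots_deficit m i"
proof (rule decseq_ge[OF _ roots_deficit_tendsto])
  show "decseq (roots_deficit m)"
  proof (rule decseq_SucI)
    fix n show "roots_deficit m (Suc n) \<le> roots_deficit m n"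
      using roots_deficit_diff[of n] block_excess_pos[OF m, of n] by simp
  qed
qed

text \<open>
  Summation by parts reduces this to the summability of \<open>2 ^ i * block_excess m i\<close>; the boundary term is only
  known to be bounded, which is enough for a series with nonnegative terms.
\<close>
lemma summable_roots_deficit: "summable (\<lambda>i. 2 ^ i * roots_deficit m i)"
proof -
  obtain C where C: "\<forall>i. 2 ^ i * \<bar>roots_deficit m i\<bar> \<le> C"
    using roots_deficit_bound by blast
  show ?thesis
  proof (rule summableI_nonneg_bounded)
    show "0 \<le> 2 ^ i * roots_deficit m i" for i using roots_deficit_nonneg[of i] by simp
    fix K
    have "(\<Sum>i<K. 2 ^ i * roots_deficit m i)
        = 2 ^ K * roots_deficit m K - roots_deficit m 0 + 2 * (\<Sum>i<K. 2 ^ i * block_excess m i)"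
      by (induction K) (simp_all add: algebra_simps flip: roots_deficit_diff)
    also have "\<dots> \<le> C + 2 * (\<Sum>i. 2 ^ i * block_excess m i)"
    proof -
      have "2 ^ K * roots_deficit m K \<le> C"
        using C roots_deficit_nonneg[of K] by (metis abs_of_nonneg)
      moreover have "(\<Sum>i<K. 2 ^ i * block_excess m i) \<le> (\<Sum>i. 2 ^ i * block_excess m i)"
        using block_excess_pos[OF m] by (intro sum_le_suminf summable_block_excess[OF m]) (auto intro: less_imp_le)
      ultimately show ?thesis using roots_deficit_nonneg[of 0] by linarith
    qed
    finally show "(\<Sum>i<K. 2 ^ i * roots_deficit m i) \<le> C + 2 * (\<Sum>i. 2 ^ i * block_excess m i)" .
  qed
qed

lemma summable_jacobsthal_excess: "summable (\<lambda>i. (2 ^ Suc i + (-1) ^ i) * block_excess m i)"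
proof -
  have bnd: "\<bar>(2 ^ Suc i + (-1) ^ i) * block_excess m i\<bar> \<le> 3 * (2 ^ i * block_excess m i)" for i
  proof -
    have "\<bar>2 ^ Suc i + (-1) ^ i :: real\<bar> \<le> 3 * 2 ^ i"
    proof -
      have "\<bar>2 ^ Suc i + (-1) ^ i :: real\<bar> \<le> \<bar>2 ^ Suc i\<bar> + \<bar>(-1) ^ i\<bar>"
        by (rule abs_triangle_ineq)
      moreover have "(1::real) \<le> 2 ^ i" by simp
      moreover have "\<bar>(-1) ^ i\<bar> = (1::real)" "\<bar>2 ^ Suc i\<bar> = (2 * 2 ^ i :: real)"
        by (simp_all add: power_abs)
      ultimately show ?thesis by linarith
    qed
    then show ?thesis
      using block_excess_pos[OF m, of i] by (simp add: abs_mult mult_right_mono flip: mult.assoc)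
  qed
  show ?thesis
    by (rule summable_comparison_test'[OF summable_mult[OF summable_block_excess[OF m]], where N = 0])
      (use bnd in simp)
qed

text \<open>
  Summation by parts with \<open>block_excess m i\<close> as the difference of consecutive deficits. The boundary
  term now tends to \<open>0\<close>.
\<close>
lemma jacobsthal_series:
  "(\<lambda>k. (2 ^ k + 2 * (-1) ^ k) * roots_deficit m k) sums (\<Sum>i. (2 ^ Suc i + (-1) ^ i) * block_excess m i)"
proof -
  have 1: "(\<lambda>K. \<Sum>i<K. (2 ^ Suc i + (-1) ^ i) * block_excess m i)
      \<longlonglongrightarrow> (\<Sum>i. (2 ^ Suc i + (-1) ^ i) * block_excess m i)"
    by (rule summable_LIMSEQ[OF summable_jacobsthal_excess])
  have 2: "(\<lambda>K. (2 ^ K - (-1) ^ K) * roots_deficit m K) \<longlonglongrightarrow> 0"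
  proof (rule Lim_null_comparison)
    show "(\<lambda>K. 2 * (2 ^ K * roots_deficit m K)) \<longlonglongrightarrow> 0"
      using summable_LIMSEQ_zero[OF summable_roots_deficit] by (rule tendsto_mult_right_zero)
    have "norm ((2 ^ K - (-1) ^ K) * roots_deficit m K) \<le> 2 * (2 ^ K * roots_deficit m K)" for K
    proof -
      have "\<bar>2 ^ K - (-1) ^ K :: real\<bar> \<le> 2 * 2 ^ K"
      proof -
        have "\<bar>2 ^ K - (-1) ^ K :: real\<bar> \<le> \<bar>2 ^ K\<bar> + \<bar>(-1) ^ K\<bar>"
          by (rule abs_triangle_ineq4)
        moreover have "(1::real) \<le> 2 ^ K" by simp
        moreover have "\<bar>(-1) ^ K\<bar> = (1::real)" "\<bar>2 ^ K\<bar> = (2 ^ K :: real)"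
          by (simp_all add: power_abs)
        ultimately show ?thesis by linarith
      qed
      then show ?thesis
        using roots_deficit_nonneg[of K] by (simp add: abs_mult mult_right_mono flip: mult.assoc)
    qed
    then show "\<forall>\<^sub>F K in sequentially.
        norm ((2 ^ K - (-1) ^ K) * roots_deficit m K) \<le> 2 * (2 ^ K * roots_deficit m K)"
      by (simp add: always_eventually)
  qed
  have "(\<Sum>k<K. (2 ^ k + 2 * (-1) ^ k) * roots_deficit m k)
      = (\<Sum>i<K. (2 ^ Suc i + (-1) ^ i) * block_excess m i) + (2 ^ K - (-1) ^ K) * roots_deficit m K" for K
    by (induction K) (simp_all add: algebra_simps flip: roots_deficit_diff)
  then show ?thesis
    using tendsto_add[OF 1 2] by (simp add: sums_def)
qed

lemma dyadic_distance_excess_bound: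
  "norm (real (dyadic_distance i N) * block_excess m i) \<le> 2 ^ i * block_excess m i"
proof -
  have "real (dyadic_distance i N) \<le> 2 ^ i"
    using dyadic_distance_le[of i N] by (metis of_nat_le_iff of_nat_numeral of_nat_power)
  then show ?thesis
    using block_excess_pos[OF m, of i] by (simp add: abs_mult)
qed

lemma summable_excess_series: "summable (\<lambda>i. real (dyadic_distance i N) * block_excess m i)"
  by (rule summable_comparison_test'[OF summable_block_excess[OF m] dyadic_distance_excess_bound])

lemma excess_series_nonneg: "0 \<le> excess_series m N"
  unfolding excess_series_def
  by (intro suminf_nonneg summable_excess_series mult_nonneg_nonneg of_nat_0_le_iff
       less_imp_le[OF block_excess_pos[OF m]])

lemma excess_series_le: "excess_series m N \<le> (\<Sum>i. 2 ^ i * block_excess m i)"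
  unfolding excess_series_def using dyadic_distance_excess_bound
  by (intro suminf_le summable_excess_series summable_block_excess[OF m]) (auto dest: abs_le_D1)

lemma excess_series_2_pos: "0 < excess_series m 2"
  unfolding excess_series_def
proof (rule suminf_pos2[OF summable_excess_series, where i = 1])
  show "0 \<le> real (dyadic_distance i 2) * block_excess m i" for i
    using block_excess_pos[OF m, of i] by simp
  show "0 < real (dyadic_distance 1 2) * block_excess m 1"
    using block_excess_pos[OF m, of 1] by (simp add: dyadic_distance_self)
qed

text \<open>
  Tannery's theorem with the dominating series \<open>2 ^ i * block_excess m i\<close>.
\<close>
lemma excess_series_tendsto:
  assumes "\<And>i. \<forall>\<^sub>F n in sequentially. real (dyadic_distance i (r n)) = g i"
  shows "(\<lambda>n. excess_series m (r n)) \<longlonglongrightarrow> (\<Sum>i. g i * block_excess m i)"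
proof -
  have lim: "(\<lambda>n. real (dyadic_distance i (r n)) * block_excess m i) \<longlonglongrightarrow> g i * block_excess m i" for i
    using assms[of i] by (intro tendsto_intros tendsto_eventually)
  have "\<forall>\<^sub>F (i, n) in at_top \<times>\<^sub>F sequentially.
      norm (real (dyadic_distance i (r n)) * block_excess m i) \<le> 2 ^ i * block_excess m i"
    by (rule always_eventually) (simp add: dyadic_distance_excess_bound del: real_norm_def)
  from tannerys_theorem[OF lim this summable_block_excess[OF m]] show ?thesis
    by (simp add: excess_series_def)
qed

lemma excess_series_power_tendsto: "(\<lambda>n. excess_series m (2 ^ n)) \<longlonglongrightarrow> 0"
proof -
  have "\<forall>\<^sub>F n in sequentially. real (dyadic_distance i (2 ^ n)) = 0" for i
    using eventually_gt_at_top[of i] by eventually_elim (simp add: dyadic_distance_power)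
  from excess_series_tendsto[OF this] show ?thesis by simp
qed

lemma excess_series_shift_tendsto: "(\<lambda>n. excess_series m (N + 2 ^ n)) \<longlonglongrightarrow> excess_series m N"
  unfolding excess_series_def[of m N]
proof (rule excess_series_tendsto)
  show "\<forall>\<^sub>F n in sequentially. real (dyadic_distance i (N + 2 ^ n)) = real (dyadic_distance i N)" for i
    using eventually_gt_at_top[of i] by eventually_elim (simp add: dyadic_distance_add_power)
qed

lemma excess_series_jacobsthal_tendsto:
  "(\<lambda>n. excess_series m (jacobsthal (n + 2))) \<longlonglongrightarrow> (\<Sum>k. (2 ^ k + 2 * (-1) ^ k) * roots_deficit m k) / 3"
proof -
  have "\<forall>\<^sub>F n in sequentially. real (dyadic_distance i (jacobsthal (n + 2))) = (2 ^ Suc i + (-1) ^ i) / 3" for i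
    using eventually_gt_at_top[of i] by eventually_elim (rule dyadic_distance_jacobsthal, simp)
  from excess_series_tendsto[OF this]
  have "(\<lambda>n. excess_series m (jacobsthal (n + 2))) \<longlonglongrightarrow> (\<Sum>i. (2 ^ Suc i + (-1) ^ i) / 3 * block_excess m i)" .
  moreover have "(\<Sum>i. (2 ^ Suc i + (-1) ^ i) / 3 * block_excess m i)
      = (\<Sum>i. (2 ^ Suc i + (-1) ^ i) * block_excess m i) / 3"
    by (subst suminf_divide[OF summable_jacobsthal_excess, symmetric]) simp
  ultimately show ?thesis
    by (simp only: sums_unique[OF jacobsthal_series])
qed

end

lemma roots_energy_eq:
  assumes l: "1 < l" "l < 2"
  shows "roots_energy l (2 ^ k) = 2 ^ k * block_potential (l/2) k 0"
proof -
  have "2 powr l * sin (pi * real j / 2 ^ k) powr l = cmod (cis (2 * pi * real j / 2 ^ k) - 1) powr l"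
    if "j \<in> {1..2 ^ k - 1}" for j
  proof -
    have "j \<le> 2 ^ k" using that by auto
    then have "real j \<le> real (2 ^ k)" by (rule of_nat_mono)
    then have "real j \<le> 2 ^ k" by simp
    then have "0 \<le> sin (pi * real j / 2 ^ k)"
      by (intro sin_ge_zero) (auto simp: field_simps)
    moreover have "cmod (cis (2 * t) - 1) = 2 * \<bar>sin t\<bar>" for t
    proof -
      have "(cmod (cis (2 * t) - 1))\<^sup>2 = (- (2 * (sin t)\<^sup>2))\<^sup>2 + (2 * sin t * cos t)\<^sup>2"
        unfolding cmod_power2 by (simp add: cos_double_sin sin_double)
      also have "\<dots> = (2 * sin t)\<^sup>2 * ((sin t)\<^sup>2 + (cos t)\<^sup>2)"
        by algebra
      also have "\<dots> = (2 * \<bar>sin t\<bar>)\<^sup>2" by (simp add: power_mult_distrib)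
      finally have "(cmod (cis (2 * t) - 1))\<^sup>2 = (2 * \<bar>sin t\<bar>)\<^sup>2" .
      then show ?thesis by (rule power2_eq_imp_eq) auto
    qed
    from this[of "pi * real j / 2 ^ k"]
    have "cmod (cis (2 * pi * real j / 2 ^ k) - 1) = 2 * \<bar>sin (pi * real j / 2 ^ k)\<bar>"
      by (simp add: mult.assoc)
    ultimately show ?thesis by (simp add: powr_mult)
  qed
  then have "2 powr l * (\<Sum>j = 1..2 ^ k - 1. sin (pi * real j / 2 ^ k) powr l)
      = (\<Sum>j = 1..2 ^ k - 1. cmod (cis (2 * pi * real j / 2 ^ k) - 1) powr l)"
    unfolding sum_distrib_left by (intro sum.cong refl)
  also have "\<dots> = (\<Sum>j<2 ^ k. cmod (cis (2 * pi * real j / 2 ^ k) - 1) powr l)"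
  proof (rule sum.mono_neutral_left)
    show "{1..2 ^ k - 1} \<subseteq> {..<2 ^ k :: nat}"
    proof
      fix j :: nat assume "j \<in> {1..2 ^ k - 1}"
      moreover have "(0::nat) < 2 ^ k" by simp
      ultimately show "j \<in> {..<2 ^ k}" unfolding atLeastAtMost_iff lessThan_iff by linarith
    qed
  qed (auto simp: not_le Suc_le_eq)
  also have "\<dots> = block_potential (l/2) k 0"
    using sum_chords_equally_spaced[OF l, where y = 1 and s = 0 and i = k] by simp
  finally show ?thesis by (simp add: roots_energy_def)
qed

lemma s_term_eq:
  assumes l: "1 < l" "l < 2"
  shows "s_term l k = - ((2 ^ k + 2 * (-1) ^ k) * roots_deficit (l/2) k)"
proof -
  have "(2::real) powi (int k - 1) = 2 ^ k / 2"
    by (simp add: power_int_diff)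
  then have "1 + (-1) ^ k / 2 powi (int k - 1) = (2 ^ k + 2 * (-1) ^ k) / (2 ^ k :: real)"
    by (simp add: field_simps)
  moreover have "roots_energy l (2 ^ k) - 2 ^ (2 * k) * cont_energy l sigma1
      = - (2 ^ k * roots_deficit (l/2) k)"
    unfolding roots_energy_eq[OF l] cont_energy_eq_mean_potential[OF l] roots_deficit_def
    by (simp add: mult_2 power_add right_diff_distrib mult.assoc del: mult_2_right)
  ultimately show ?thesis unfolding s_term_def by simp
qed

text \<open>
  The \<open>n\<close>-th point contributes twice its potential, minus \<open>(2 * n + 1)\<close> times the continuous energy.
  Expanding \<open>n\<close> in binary and the continuous energy as the sum of all excesses, this contribution is
  the sum of \<open>\<plusminus> block_excess\<close>, with sign \<open>+\<close> exactly at the binary digits \<open>1\<close> of \<open>n\<close>.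
\<close>
theorem energy_diff_eq_excess_series:
  assumes l: "1 < l" "l < 2" and greedy: "greedy_energy_seq l a"
  shows "energy_diff l a N = - excess_series (l/2) N"
proof -
  note m = half_exponent[OF l]
  have unit: "\<And>k. cmod (a k) = 1" using greedy by (simp add: greedy_energy_seq_def S1_def)
  define J e where "J = mean_potential (l/2)" and "e = block_excess (l/2)"
  define u where "u = (\<lambda>n. 2 * (\<Sum>k<n. cmod (a n - a k) powr l) - (2 * real n + 1) * J)"
  have u: "(\<lambda>i. - ((-1) ^ (n div 2 ^ i) * e i)) sums u n" for n
  proof -
    \<comment> \<open>The excesses with index at least \<open>M\<close> are missing from this partial sum; all of them carry
      the sign \<open>-\<close>, and \<open>roots_deficit (l/2) M\<close> is the sum of these excesses.\<close>
    have part: "(\<Sum>i<M. - ((-1) ^ (n div 2 ^ i) * e i)) = u n + roots_deficit (l/2) M" if "n \<le> M" for M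
    proof -
      have n: "n < 2 ^ M" using that less_exp[of M] by linarith
      have "(\<Sum>i<M. - ((-1) ^ (n div 2 ^ i) * e i))
          = (\<Sum>i<M. 2 * (if odd (n div 2 ^ i) then block_potential (l/2) i 4 else 0)
              - 2 * J * (if odd (n div 2 ^ i) then 2 ^ i else 0) - e i)"
        by (intro sum.cong refl) (auto simp: e_def J_def block_excess_def algebra_simps)
      also have "\<dots> = 2 * (\<Sum>k<n. cmod (a n - a k) powr l) - 2 * J * real n - (J - roots_deficit (l/2) M)"
        using greedy_potential[OF l unit greedy n] nat_eq_sum_binary_digits[OF n] sum_block_excess[OF m, of M]
        by (simp only: sum_subtractf sum_distrib_left[symmetric] e_def J_def)
      finally show ?thesis by (simp add: u_def algebra_simps)
    qed
    have "(\<lambda>M. u n + roots_deficit (l/2) M) \<longlonglongrightarrow> u n + 0"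
      by (intro tendsto_intros roots_deficit_tendsto m)
    moreover have "\<forall>\<^sub>F M in sequentially.
        u n + roots_deficit (l/2) M = (\<Sum>i<M. - ((-1) ^ (n div 2 ^ i) * e i))"
      using eventually_ge_at_top[of n] by eventually_elim (simp only: part)
    ultimately show ?thesis
      unfolding sums_def by (simp add: Lim_transform_eventually)
  qed
  have "energy_diff l a N = (\<Sum>n<N. u n)"
  proof -
    have "(real N)\<^sup>2 = (\<Sum>n<N. 2 * real n + 1)"
      by (induction N) (auto simp: power2_eq_square algebra_simps)
    then show ?thesis
      by (simp add: energy_diff_def energy_eq_sum_potentials cont_energy_eq_mean_potential[OF l] u_def J_def
           sum_subtractf sum_distrib_left sum_distrib_right)
  qed
  moreover have "(\<lambda>i. \<Sum>n<N. - ((-1) ^ (n div 2 ^ i) * e i)) sums (\<Sum>n<N. u n)"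
    by (intro sums_sum u)
  then have "(\<lambda>i. - (real (dyadic_distance i N) * e i)) sums (\<Sum>n<N. u n)"
    by (simp add: dyadic_distance_eq_sum sum_distrib_right sum_negf)
  then have "(\<Sum>n<N. u n) = - excess_series (l/2) N"
    unfolding excess_series_def e_def[symmetric]
    using sums_minus by (auto simp: sums_iff dest: suminf_minus) 
  ultimately show ?thesis by simp
qed

theorem theorem3p17:
  fixes l :: real and a :: "nat \<Rightarrow> complex"
  assumes "1 < l" and "l < 2"
    and "greedy_energy_seq l a" and "a 0 = 1"
  shows "bounded (energy_diff l a ` {2..})
    \<and> \<not> convergent (energy_diff l a)
    \<and> limsup (\<lambda>N. ereal (energy_diff l a N)) = 0
    \<and> summable (s_term l)
    \<and> liminf (\<lambda>N. ereal (energy_diff l a N)) \<le> ereal (s_const l)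
    \<and> liminf (\<lambda>N. ereal (energy_diff l a N)) = (INF N\<in>{2..}. ereal (energy_diff l a N))
    \<and> (\<forall>N\<ge>2. \<exists>r :: nat \<Rightarrow> nat. strict_mono r \<and> (\<forall>n. 2 \<le> r n)
          \<and> (\<lambda>n. energy_diff l a (r n)) \<longlonglongrightarrow> energy_diff l a N)"
proof -
  note l = assms(1,2)
  note m = half_exponent[OF l]
  define D where "D = energy_diff l a"
  have D: "D N = - excess_series (l/2) N" for N
    unfolding D_def by (rule energy_diff_eq_excess_series[OF l assms(3)])
  have D_le: "D N \<le> 0" for N using excess_series_nonneg[OF m] by (simp add: D)
  have power: "(\<lambda>n. D (2 ^ n)) \<longlonglongrightarrow> 0"
    using tendsto_minus[OF excess_series_power_tendsto[OF m]] by (simp add: D)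
  have shift: "(\<lambda>n. D (N + 2 ^ n)) \<longlonglongrightarrow> D N" for N
    using tendsto_minus[OF excess_series_shift_tendsto[OF m]] by (simp add: D)
  have mono_power: "strict_mono (\<lambda>n. 2 ^ n :: nat)" by (rule strict_monoI_Suc) simp
  have mono_shift: "strict_mono (\<lambda>n. N + 2 ^ n :: nat)" for N by (rule strict_monoI_Suc) simp
  have liminf_le: "liminf (\<lambda>N. ereal (D N)) \<le> ereal x"
    if "strict_mono r" "(\<lambda>n. D (r n)) \<longlonglongrightarrow> x" for r x
  proof -
    have "liminf ((\<lambda>N. ereal (D N)) \<circ> r) = ereal x"
      using that(2) by (intro lim_imp_Liminf) (auto simp: o_def)
    then show ?thesis using liminf_subseq_mono[OF that(1), of "\<lambda>N. ereal (D N)"] by simp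
  qed
  have s: "(\<lambda>k. s_term l k) sums - (\<Sum>k. (2 ^ k + 2 * (-1) ^ k) * roots_deficit (l/2) k)"
    unfolding s_term_eq[OF l] using jacobsthal_series[OF m] by (intro sums_minus) (simp add: sums_iff)
  have "bounded (D ` {2..})"
  proof (rule boundedI)
    fix x assume "x \<in> D ` {2..}"
    then show "norm x \<le> (\<Sum>i. 2 ^ i * block_excess (l/2) i)"
      using excess_series_nonneg[OF m] excess_series_le[OF m] by (auto simp: D)
  qed
  moreover have "\<not> convergent D"
  proof
    assume "convergent D"
    then obtain c where c: "D \<longlonglongrightarrow> c" by (auto simp: convergent_def)
    have "c = 0" "c = D 2"
      using LIMSEQ_unique[OF LIMSEQ_subseq_LIMSEQ[OF c mono_power]] power
        LIMSEQ_unique[OF LIMSEQ_subseq_LIMSEQ[OF c mono_shift]] shift by (auto simp: o_def)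
    then show False using excess_series_2_pos[OF m] by (simp add: D)
  qed
  moreover have "limsup (\<lambda>N. ereal (D N)) = 0"
  proof (rule antisym)
    show "limsup (\<lambda>N. ereal (D N)) \<le> 0"
      by (intro Limsup_bounded always_eventually) (simp add: D_le)
    have "limsup ((\<lambda>N. ereal (D N)) \<circ> (\<lambda>n. 2 ^ n)) = ereal 0"
      using power by (intro lim_imp_Limsup) (auto simp: o_def)
    then show "0 \<le> limsup (\<lambda>N. ereal (D N))"
      using limsup_subseq_mono[OF mono_power, of "\<lambda>N. ereal (D N)"] by (simp add: zero_ereal_def)
  qed
  moreover have "summable (s_term l)" using s by (simp add: sums_iff)
  moreover have "liminf (\<lambda>N. ereal (D N)) \<le> ereal (s_const l)"
  proof (rule liminf_le[OF strict_mono_jacobsthal])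
    have "s_const l = - ((\<Sum>k. (2 ^ k + 2 * (-1) ^ k) * roots_deficit (l/2) k) / 3)"
      using sums_unique[OF s] by (simp add: s_const_def)
    then show "(\<lambda>n. D (jacobsthal (n + 2))) \<longlonglongrightarrow> s_const l"
      using tendsto_minus[OF excess_series_jacobsthal_tendsto[OF m]] by (simp add: D)
  qed
  moreover have "liminf (\<lambda>N. ereal (D N)) = (INF N\<in>{2..}. ereal (D N))"
  proof (rule antisym)
    show "liminf (\<lambda>N. ereal (D N)) \<le> (INF N\<in>{2..}. ereal (D N))"
      by (intro INF_greatest liminf_le[OF mono_shift shift])
    have "\<forall>\<^sub>F N in sequentially. (INF N\<in>{2..}. ereal (D N)) \<le> ereal (D N)"
      using eventually_ge_at_top[of 2] by eventually_elim (auto intro: INF_lower)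
    then show "(INF N\<in>{2..}. ereal (D N)) \<le> liminf (\<lambda>N. ereal (D N))"
      by (rule Liminf_bounded)
  qed
  moreover have "\<exists>r. strict_mono r \<and> (\<forall>n. 2 \<le> r n) \<and> (\<lambda>n. D (r n)) \<longlonglongrightarrow> D N" if "2 \<le> N" for N
    using mono_shift[of N] shift[of N] that by (intro exI[of _ "\<lambda>n. N + 2 ^ n"]) (auto intro: trans_le_add1)
  ultimately show ?thesis unfolding D_def by blast
qed

end
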